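(* Let $M$ be a finite abelian group and let $\langle\,,\rangle: M\times M\to \mathbf{Q}/\mathbf{Z}$ be a symmetric bilinear form. For each prime $p$ consider the $\mathbf{Z}/p\mathbf{Z}$-vector spaces $V_{p,\mathrm{odd}}$ and $V_{p,\mathrm{even}}$ with their symmetric bilinear forms $\langle\,,\rangle_{p,\mathrm{odd}}$ and $\langle\,,\rangle_{p,\mathrm{even}}$ (defined in the context). Then the following statements are equivalent: (i) for all primes $p$ the forms on $V_{p,\mathrm{odd}}$ and $V_{p,\mathrm{even}}$ are anisotropic as forms of $\mathbf{Z}/p\mathbf{Z}$-vector spaces; (ii) $\langle\,,\rangle$ is non-degenerate and there exists a unique subgroup $L\subseteq M$ such that $L\subseteq L^{\perp}$ and $L^{\perp}/L$ is semi-simple.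
   Context: By the structure theorem write $M=\bigoplus_{p,i}F_{p,i}$, where $p$ ranges over the primes, $i\in\mathbf{Z}_{>0}$, and $F_{p,i}\subseteq M$ is a free module over $\mathbf{Z}/p^i\mathbf{Z}$ (fix such a decomposition). For a prime $p$ put $V_{p,\mathrm{odd}}=\bigoplus_{i\text{ odd}}F_{p,i}/pF_{p,i}$ and $V_{p,\mathrm{even}}=\bigoplus_{i\text{ even}}F_{p,i}/pF_{p,i}$. The form on $V_{p,\mathrm{odd}}$ is $$\langle (x_i)_{i},(y_i)_{i}\rangle_{p,\mathrm{odd}}=\sum_{i\text{ odd}}p^{i-1}\langle x_i,y_i\rangle\in p^{-1}\mathbf{Z}/\mathbf{Z}\cong\mathbf{Z}/p\mathbf{Z},$$ where on the right $x_i,y_i\in F_{p,i}$ are representatives of the classes; the form $\langle\,,\rangle_{p,\mathrm{even}}$ on $V_{p,\mathrm{even}}$ is defined by the same formula with the sum over even $i$. A symmetric bilinear form $V\times V\to W$, with $V$ a finite-dimensional and $W$ a $1$-dimensional vector space over a field, is anisotropic if $\langle v,v\rangle\neq 0$ for all nonzero $v\in V$. The form $\langle\,,\rangle$ on $M$ is non-degenerate if $M\to\mathrm{Hom}(M,\mathbf{Q}/\mathbf{Z})$, $m\mapsto(m'\mapsto\langle m,m'\rangle)$, is an isomorphism. For a subgroup $L\subseteq M$, $L^{\perp}=\{x\in M:\langle x,l\rangle=0\text{ for all }l\in L\}$. A finite abelian group is semi-simple if its exponent is squarefree. *)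

theory Defs
  imports "HOL-Algebra.Free_Abelian_Groups" "HOL-Computational_Algebra.Squarefree"
begin

text \<open>Groups are in the sense of HOL-Algebra, hence written multiplicatively: the zero of
  \<open>M\<close> is \<open>\<one>\<^bsub>M\<^esub>\<close> and the multiple \<open>n x\<close> is \<open>x [^]\<^bsub>M\<^esub> n\<close>.
  An abelian group killed by the prime \<open>p\<close> carries exactly one structure of vector space over
  \<open>\<int>/p\<int>\<close>, and every biadditive map between such groups is bilinear; this structure is
  therefore not recorded separately.\<close>

subsection \<open>The group $\mathbf{Q}/\mathbf{Z}$ and its subgroups $p^{-1}\mathbf{Z}/\mathbf{Z}$\<close>

definition rat_group :: "rat monoid"
  where "rat_group = \<lparr>carrier = UNIV, monoid.mult = (+), one = 0\<rparr>"

definition QZ :: "rat set monoid"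
  where "QZ = rat_group Mod \<int>"

definition inv_multiples_mod_Z :: "nat \<Rightarrow> rat set monoid"
  where "inv_multiples_mod_Z p =
    QZ\<lparr>carrier := (\<lambda>r. \<int> #>\<^bsub>rat_group\<^esub> r) ` {r. of_nat p * r \<in> \<int>}\<rparr>"


subsection \<open>Symmetric bilinear forms\<close>

definition symmetric_bilinear_form ::
    "('a, 'b) monoid_scheme \<Rightarrow> ('c, 'd) monoid_scheme \<Rightarrow> ('a \<Rightarrow> 'a \<Rightarrow> 'c) \<Rightarrow> bool"
  where "symmetric_bilinear_form V W \<beta> \<longleftrightarrow>
    (\<forall>x\<in>carrier V. (\<lambda>y. \<beta> x y) \<in> hom V W) \<and>
    (\<forall>y\<in>carrier V. (\<lambda>x. \<beta> x y) \<in> hom V W) \<and>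
    (\<forall>x\<in>carrier V. \<forall>y\<in>carrier V. \<beta> x y = \<beta> y x)"

definition anisotropic ::
    "('a, 'b) monoid_scheme \<Rightarrow> ('c, 'd) monoid_scheme \<Rightarrow> ('a \<Rightarrow> 'a \<Rightarrow> 'c) \<Rightarrow> bool"
  where "anisotropic V W \<beta> \<longleftrightarrow> (\<forall>v\<in>carrier V. v \<noteq> \<one>\<^bsub>V\<^esub> \<longrightarrow> \<beta> v v \<noteq> \<one>\<^bsub>W\<^esub>)"

text \<open>The restrictions below make homomorphisms that agree on the carrier equal.\<close>

definition Hom_group :: "('a, 'b) monoid_scheme \<Rightarrow> ('c, 'd) monoid_scheme \<Rightarrow> ('a \<Rightarrow> 'c) monoid"
  where "Hom_group G H =
    \<lparr>carrier = hom G H \<inter> extensional (carrier G),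
     monoid.mult = (\<lambda>f g. \<lambda>x\<in>carrier G. f x \<otimes>\<^bsub>H\<^esub> g x),
     one = (\<lambda>x\<in>carrier G. \<one>\<^bsub>H\<^esub>)\<rparr>"

definition nondegenerate :: "('a, 'b) monoid_scheme \<Rightarrow> ('a \<Rightarrow> 'a \<Rightarrow> rat set) \<Rightarrow> bool"
  where "nondegenerate M \<beta> \<longleftrightarrow>
    (\<lambda>m. \<lambda>m'\<in>carrier M. \<beta> m m') \<in> iso M (Hom_group M QZ)"

definition perp :: "('a, 'b) monoid_scheme \<Rightarrow> ('a \<Rightarrow> 'a \<Rightarrow> rat set) \<Rightarrow> 'a set \<Rightarrow> 'a set"
  where "perp M \<beta> L = {x \<in> carrier M. \<forall>l\<in>L. \<beta> x l = \<one>\<^bsub>QZ\<^esub>}"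


subsection \<open>Semi-simple groups\<close>

definition group_exponent :: "('a, 'b) monoid_scheme \<Rightarrow> nat"
  where "group_exponent G = (LEAST n. 0 < n \<and> (\<forall>x\<in>carrier G. x [^]\<^bsub>G\<^esub> n = \<one>\<^bsub>G\<^esub>))"

definition semisimple_group :: "('a, 'b) monoid_scheme \<Rightarrow> bool"
  where "semisimple_group G \<longleftrightarrow> squarefree (group_exponent G)"


subsection \<open>Decompositions $M=\bigoplus_{p,i}F_{p,i}$\<close>

text \<open>A free module (of finite rank) over \<open>\<int>/q\<int>\<close> is one isomorphic to a direct sum of copies
  of \<open>\<int>/q\<int>\<close>; a group isomorphism between modules over \<open>\<int>/q\<int>\<close> is linear.\<close>

definition free_mod :: "nat \<Rightarrow> ('a, 'b) monoid_scheme \<Rightarrow> bool"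
  where "free_mod q G \<longleftrightarrow> (\<exists>n::nat. G \<cong> sum_group {..<n} (\<lambda>_. integer_mod_group q))"

definition primary_decomposition ::
    "('a, 'b) monoid_scheme \<Rightarrow> (nat \<Rightarrow> nat \<Rightarrow> 'a set) \<Rightarrow> bool"
  where "primary_decomposition M F \<longleftrightarrow>
    (let I = {(p, i). Factorial_Ring.prime p \<and> 0 < i} in
      (\<forall>(p, i)\<in>I. subgroup (F p i) M \<and> free_mod (p ^ i) (M\<lparr>carrier := F p i\<rparr>)) \<and>
      (\<lambda>x. gfinprod M x I) \<in> iso (sum_group I (\<lambda>(p, i). M\<lparr>carrier := F p i\<rparr>)) M)"


subsection \<open>The spaces $V_{p,\mathrm{odd}}$, $V_{p,\mathrm{even}}$ and their forms\<close>

definition odd_indices :: "nat set"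
  where "odd_indices = {i. 0 < i \<and> odd i}"

definition even_indices :: "nat set"
  where "even_indices = {i. 0 < i \<and> even i}"

definition V_space ::
    "('a, 'b) monoid_scheme \<Rightarrow> (nat \<Rightarrow> nat \<Rightarrow> 'a set) \<Rightarrow> nat \<Rightarrow> nat set \<Rightarrow> (nat \<Rightarrow> 'a set) monoid"
  where "V_space M F p J =
    sum_group J (\<lambda>i. M\<lparr>carrier := F p i\<rparr> Mod ((\<lambda>x. x [^]\<^bsub>M\<^esub> p) ` F p i))"

text \<open>An element of \<open>V_space\<close> is a family of cosets, so a representative of its \<open>i\<close>-th component
  \<open>v i\<close> is just an element of \<open>v i\<close>.  By \<open>V_form_representatives\<close> below their choice is
  irrelevant.\<close>

definition V_form ::
    "('a \<Rightarrow> 'a \<Rightarrow> rat set) \<Rightarrow> nat \<Rightarrow> nat set \<Rightarrow> (nat \<Rightarrow> 'a set) \<Rightarrow> (nat \<Rightarrow> 'a set) \<Rightarrow> rat set"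
  where "V_form \<beta> p J v w =
    gfinprod QZ (\<lambda>i. \<beta> (SOME x. x \<in> v i) (SOME y. y \<in> w i) [^]\<^bsub>QZ\<^esub> (p ^ (i - 1))) J"


subsection \<open>The forms on $V_{p,\mathrm{odd}}$ and $V_{p,\mathrm{even}}$ are well defined\<close>

lemma comm_group_rat_group: "comm_group rat_group"
proof (rule comm_groupI)
  fix x assume "x \<in> carrier rat_group"
  show "\<exists>y\<in>carrier rat_group. y \<otimes>\<^bsub>rat_group\<^esub> x = \<one>\<^bsub>rat_group\<^esub>"
    by (rule bexI[of _ "- x"]) (auto simp: rat_group_def)
qed (auto simp: rat_group_def)

lemma subgroup_Ints_rat_group: "subgroup \<int> rat_group"
proof -
  have "inv\<^bsub>rat_group\<^esub> x = - x" for x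
    by (rule group.inv_equality)
       (use comm_group_rat_group in \<open>auto simp: comm_group_def rat_group_def\<close>)
  then show ?thesis
    by unfold_locales (auto simp: rat_group_def)
qed

lemma comm_group_QZ: "comm_group QZ"
  unfolding QZ_def by (rule comm_group.abelian_FactGroup[OF comm_group_rat_group subgroup_Ints_rat_group])

interpretation QZ: comm_group QZ
  by (rule comm_group_QZ)

lemma carrier_inv_multiples_mod_Z:
  "carrier (inv_multiples_mod_Z p) = {c \<in> carrier QZ. c [^]\<^bsub>QZ\<^esub> p = \<one>\<^bsub>QZ\<^esub>}"
proof -
  interpret normal "\<int>" rat_group
    by (rule comm_group.normal_iff_subgroup[OF comm_group_rat_group, THEN iffD2, OF subgroup_Ints_rat_group])
  have pow: "r [^]\<^bsub>rat_group\<^esub> p = of_nat p * r" for r p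
    by (induction p) (auto simp: rat_group_def algebra_simps)
  have "(\<int> #>\<^bsub>rat_group\<^esub> r) [^]\<^bsub>QZ\<^esub> p = \<int> \<longleftrightarrow> of_nat p * r \<in> \<int>" for r
  proof -
    have "(\<int> #>\<^bsub>rat_group\<^esub> r) [^]\<^bsub>QZ\<^esub> p = \<int> #>\<^bsub>rat_group\<^esub> (of_nat p * r)"
      unfolding QZ_def by (subst FactGroup_pow) (auto simp: pow, simp add: rat_group_def)
    moreover have "\<int> #>\<^bsub>rat_group\<^esub> s = \<int> \<longleftrightarrow> s \<in> \<int>" for s
      by (metis UNIV_I coset_join1 rat_group_def partial_object.select_convs(1) coset_join2
            group_axioms subgroup_Ints_rat_group subset_UNIV)
    ultimately show ?thesis by simp
  qed
  then show ?thesis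
    by (auto simp: inv_multiples_mod_Z_def QZ_def carrier_FactGroup rat_group_def)
qed

lemma free_mod_pow_eq_one:
  assumes "group G" "free_mod q G" "x \<in> carrier G"
  shows "x [^]\<^bsub>G\<^esub> q = \<one>\<^bsub>G\<^esub>"
proof -
  obtain n h where h: "h \<in> iso G (sum_group {..<n::nat} (\<lambda>_. integer_mod_group q))"
    using assms(2) by (auto simp: free_mod_def is_iso_def)
  let ?S = "sum_group {..<n::nat} (\<lambda>_. integer_mod_group q)"
  have grS: "group ?S" by simp
  have hom: "h \<in> hom G ?S" and inj: "inj_on h (carrier G)"
    using h by (auto simp: iso_def bij_betw_def)
  interpret h: group_hom G ?S h
    using assms(1) grS hom by (simp add: group_hom_def group_hom_axioms_def)
  have pow: "y [^]\<^bsub>?S\<^esub> k = (\<lambda>i\<in>{..<n}. y i [^]\<^bsub>integer_mod_group q\<^esub> k)"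
    if "y \<in> carrier ?S" for y and k :: nat
  proof (induction k)
    case (Suc k)
    have "(int k * a mod int q + a) mod int q = (int (Suc k) * a) mod int q" for a
      by (simp add: mod_add_left_eq mod_add_right_eq distrib_right add.commute)
    then show ?case
      by (simp only: nat_pow_Suc Suc.IH mult_sum_group pow_integer_mod_group mult_integer_mod_group)
         (auto simp: fun_eq_iff)
  qed simp
  have "h (x [^]\<^bsub>G\<^esub> q) = h \<one>\<^bsub>G\<^esub>"
    using assms(3) by (simp add: h.hom_nat_pow pow)
  then show ?thesis
    using inj assms(3) by (meson h.G.nat_pow_closed h.G.one_closed inj_onD)
qed

context
  fixes M :: "('a, 'b) monoid_scheme" and \<beta> :: "'a \<Rightarrow> 'a \<Rightarrow> rat set"
    and F :: "nat \<Rightarrow> nat \<Rightarrow> 'a set" and p :: nat and J :: "nat set"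
  assumes M: "comm_group M" and \<beta>: "symmetric_bilinear_form M QZ \<beta>"
    and F: "primary_decomposition M F" and p: "Factorial_Ring.prime p" and J: "J \<subseteq> {0<..}"
begin

interpretation M: comm_group M by (rule M)

private abbreviation "A i \<equiv> M\<lparr>carrier := F p i\<rparr>"
private abbreviation "P i \<equiv> (\<lambda>x. x [^]\<^bsub>M\<^esub> p) ` F p i"

private lemma sub: "i \<in> J \<Longrightarrow> subgroup (F p i) M"
  and free: "i \<in> J \<Longrightarrow> free_mod (p ^ i) (A i)"
  using F p J by (auto simp: primary_decomposition_def Let_def)

private lemma in_M: "i \<in> J \<Longrightarrow> x \<in> F p i \<Longrightarrow> x \<in> carrier M"
  by (meson sub subgroup.mem_carrier)

private lemma comm_A: "i \<in> J \<Longrightarrow> comm_group (A i)"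
proof (rule group.group_comm_groupI[OF M.subgroup_imp_group[OF sub]])
  fix x y assume i: "i \<in> J" and "x \<in> carrier (A i)" "y \<in> carrier (A i)"
  then show "x \<otimes>\<^bsub>A i\<^esub> y = y \<otimes>\<^bsub>A i\<^esub> x"
    using M.m_comm[OF in_M[OF i] in_M[OF i]] by simp
qed

private lemma killed: "i \<in> J \<Longrightarrow> x \<in> F p i \<Longrightarrow> x [^]\<^bsub>M\<^esub> (p ^ i) = \<one>\<^bsub>M\<^esub>"
  using free_mod_pow_eq_one[of "A i" "p ^ i" x] free comm_A
  by (auto simp: comm_group_def M.nat_pow_consistent[symmetric])

private lemma F_pow: "i \<in> J \<Longrightarrow> x \<in> F p i \<Longrightarrow> x [^]\<^bsub>M\<^esub> (n::nat) \<in> F p i"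
  by (induction n) (auto intro: subgroup.one_closed[OF sub] subgroup.m_closed[OF sub])

private lemma sub_P: "i \<in> J \<Longrightarrow> subgroup (P i) (A i)"
proof -
  assume i: "i \<in> J"
  have hom: "(\<lambda>x. x [^]\<^bsub>M\<^esub> p) \<in> hom (A i) (A i)"
    using in_M[OF i] F_pow[OF i] by (auto simp: hom_def M.nat_pow_distrib)
  have "group_hom (A i) (A i) (\<lambda>x. x [^]\<^bsub>M\<^esub> p)"
    using hom comm_A[OF i] by (simp add: group_hom_def group_hom_axioms_def comm_group_def)
  from group_hom.img_is_subgroup[OF this] show "subgroup (P i) (A i)" by simp
qed

private lemma comm_Q: "i \<in> J \<Longrightarrow> comm_group (A i Mod P i)"
  by (rule comm_group.abelian_FactGroup[OF comm_A sub_P])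

private lemma coset_in_F:
  assumes "i \<in> J" "X \<in> carrier (A i Mod P i)" "x \<in> X"
  shows "x \<in> F p i"
  using assms sub[OF assms(1)]
  by (auto simp: carrier_FactGroup r_coset_def subgroup.m_closed F_pow)

private lemma some_in:
  assumes "i \<in> J" "X \<in> carrier (A i Mod P i)"
  shows "(SOME x. x \<in> X) \<in> X"
proof -
  have "X \<noteq> {}"
    using assms sub[OF assms(1)] by (auto simp: carrier_FactGroup r_coset_def dest: subgroup.one_closed)
  then show ?thesis by (simp add: some_in_eq)
qed

private lemma coset_diff:
  assumes i: "i \<in> J" and X: "X \<in> carrier (A i Mod P i)" "x \<in> X" "x' \<in> X"
  obtains z where "z \<in> F p i" "x' = z [^]\<^bsub>M\<^esub> p \<otimes>\<^bsub>M\<^esub> x"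
proof -
  interpret A: comm_group "A i" by (rule comm_A[OF i])
  obtain a where a: "a \<in> F p i" "X = P i #>\<^bsub>A i\<^esub> a"
    using X by (auto simp: carrier_FactGroup)
  have "X = P i #>\<^bsub>A i\<^esub> x"
    using A.repr_independence[of x "P i" a] X a sub_P[OF i] by simp
  then show thesis
    using X(3) that by (auto simp: r_coset_def)
qed

private definition g where "g i x y = \<beta> x y [^]\<^bsub>QZ\<^esub> (p ^ (i - 1))"

private lemma \<beta>_closed: "x \<in> carrier M \<Longrightarrow> y \<in> carrier M \<Longrightarrow> \<beta> x y \<in> carrier QZ"
  using \<beta> by (auto simp: symmetric_bilinear_form_def hom_def)

private lemma \<beta>_sym: "x \<in> carrier M \<Longrightarrow> y \<in> carrier M \<Longrightarrow> \<beta> x y = \<beta> y x"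
  using \<beta> by (auto simp: symmetric_bilinear_form_def)

private lemma \<beta>_pow: "x \<in> carrier M \<Longrightarrow> y \<in> carrier M \<Longrightarrow>
    \<beta> (x [^]\<^bsub>M\<^esub> (n::nat)) y = \<beta> x y [^]\<^bsub>QZ\<^esub> n"
  using \<beta> by (intro hom_nat_pow) (auto simp: symmetric_bilinear_form_def M.is_group)

private lemma g_closed: "i \<in> J \<Longrightarrow> x \<in> F p i \<Longrightarrow> y \<in> F p i \<Longrightarrow> g i x y \<in> carrier QZ"
  by (simp add: g_def \<beta>_closed in_M)

private lemma g_sym: "i \<in> J \<Longrightarrow> x \<in> F p i \<Longrightarrow> y \<in> F p i \<Longrightarrow> g i x y = g i y x"
  by (simp add: g_def \<beta>_sym in_M)

private lemma g_mult:
  assumes "i \<in> J" "x \<in> F p i" "x' \<in> F p i" "y \<in> F p i"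
  shows "g i (x \<otimes>\<^bsub>M\<^esub> x') y = g i x y \<otimes>\<^bsub>QZ\<^esub> g i x' y"
proof -
  have "\<beta> (x \<otimes>\<^bsub>M\<^esub> x') y = \<beta> x y \<otimes>\<^bsub>QZ\<^esub> \<beta> x' y"
    using \<beta> assms in_M[OF assms(1)] by (auto simp: symmetric_bilinear_form_def hom_def)
  then show ?thesis
    using assms by (simp add: g_def \<beta>_closed in_M QZ.nat_pow_distrib)
qed

private lemma \<beta>_one: "y \<in> carrier M \<Longrightarrow> \<beta> \<one>\<^bsub>M\<^esub> y = \<one>\<^bsub>QZ\<^esub>"
  using \<beta>_pow[of "\<one>\<^bsub>M\<^esub>" y 0] by simp

private lemma g_pow:
  assumes "i \<in> J" "x \<in> F p i" "y \<in> F p i"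
  shows "g i x y [^]\<^bsub>QZ\<^esub> p = \<one>\<^bsub>QZ\<^esub>" and "g i (x [^]\<^bsub>M\<^esub> p) y = \<one>\<^bsub>QZ\<^esub>"
proof -
  have i: "p ^ (i - Suc 0) * p = p ^ i" "p * p ^ (i - Suc 0) = p ^ i"
    using assms(1) J by (cases i; auto)+
  have "\<beta> x y [^]\<^bsub>QZ\<^esub> (p ^ i) = \<one>\<^bsub>QZ\<^esub>"
    using assms \<beta>_pow[of x y "p ^ i"] by (simp add: killed in_M \<beta>_one)
  then show "g i x y [^]\<^bsub>QZ\<^esub> p = \<one>\<^bsub>QZ\<^esub>" "g i (x [^]\<^bsub>M\<^esub> p) y = \<one>\<^bsub>QZ\<^esub>"
    using assms by (simp_all add: g_def \<beta>_pow in_M \<beta>_closed QZ.nat_pow_pow i)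
qed

private lemma g_cong1:
  assumes "i \<in> J" "X \<in> carrier (A i Mod P i)" "x \<in> X" "x' \<in> X" "y \<in> F p i"
  shows "g i x' y = g i x y"
proof -
  have x: "x \<in> F p i" using assms by (metis coset_in_F)
  obtain z where z: "z \<in> F p i" "x' = z [^]\<^bsub>M\<^esub> p \<otimes>\<^bsub>M\<^esub> x"
    using coset_diff assms by metis
  show ?thesis
    using assms x z by (simp add: g_mult F_pow g_pow g_closed)
qed

private lemma g_cong:
  assumes "i \<in> J" "X \<in> carrier (A i Mod P i)" "Y \<in> carrier (A i Mod P i)"
    "x \<in> X" "x' \<in> X" "y \<in> Y" "y' \<in> Y"
  shows "g i x' y' = g i x y"
  using assms by (metis g_cong1 g_sym coset_in_F)

private lemma grp_Q: "i \<in> J \<Longrightarrow> group (A i Mod P i)"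
  using comm_Q by (simp add: comm_group_def)

private lemma V_component: "v \<in> carrier (V_space M F p J) \<Longrightarrow> i \<in> J \<Longrightarrow> v i \<in> carrier (A i Mod P i)"
  by (auto simp: V_space_def carrier_sum_group grp_Q)

private lemma V_form_g:
  "V_form \<beta> p J v w = gfinprod QZ (\<lambda>i. g i (SOME x. x \<in> v i) (SOME y. y \<in> w i)) J"
  by (simp add: V_form_def g_def)

lemma V_form_representatives:
  assumes "v \<in> carrier (V_space M F p J)" "w \<in> carrier (V_space M F p J)"
    and "\<And>i. i \<in> J \<Longrightarrow> x i \<in> v i" "\<And>i. i \<in> J \<Longrightarrow> y i \<in> w i"
  shows "V_form \<beta> p J v w = gfinprod QZ (\<lambda>i. \<beta> (x i) (y i) [^]\<^bsub>QZ\<^esub> (p ^ (i - 1))) J"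
proof -
  have "\<beta> (x i) (y i) [^]\<^bsub>QZ\<^esub> (p ^ (i - 1)) \<in> carrier QZ" if i: "i \<in> J" for i
    using g_closed[OF i coset_in_F[OF i V_component[OF assms(1) i] assms(3)[OF i]]
        coset_in_F[OF i V_component[OF assms(2) i] assms(4)[OF i]]]
    by (simp add: g_def)
  moreover have "g i (SOME x. x \<in> v i) (SOME y. y \<in> w i) = \<beta> (x i) (y i) [^]\<^bsub>QZ\<^esub> (p ^ (i - 1))"
    if i: "i \<in> J" for i
    using g_cong[OF i V_component[OF assms(1) i] V_component[OF assms(2) i]
        assms(3)[OF i] some_in[OF i V_component[OF assms(1) i]]
        assms(4)[OF i] some_in[OF i V_component[OF assms(2) i]]]
    by (simp add: g_def)
  ultimately show ?thesis
    unfolding V_form_g by (intro QZ.gfinprod_cong) (auto simp: simp_implies_def)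
qed

private lemma V_form_hom:
  assumes w: "w \<in> carrier (V_space M F p J)"
  shows "(\<lambda>v. V_form \<beta> p J v w) \<in> hom (V_space M F p J) QZ"
  unfolding V_form_g V_space_def
proof (rule QZ.hom_group_sum)
  fix i assume i: "i \<in> J"
  show "group (A i Mod P i)" by (rule grp_Q[OF i])
  define y where "y = (SOME y. y \<in> w i)"
  have y: "y \<in> F p i"
    using coset_in_F i some_in V_component w y_def by metis
  show "(\<lambda>X. g i (SOME x. x \<in> X) (SOME y. y \<in> w i)) \<in> hom (A i Mod P i) QZ"
    unfolding y_def[symmetric]
  proof (rule homI)
    fix X assume X: "X \<in> carrier (A i Mod P i)"
    show "g i (SOME x. x \<in> X) y \<in> carrier QZ"
      using X i y by (metis coset_in_F g_closed some_in)
    fix Y assume Y: "Y \<in> carrier (A i Mod P i)"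
    let ?Z = "X \<otimes>\<^bsub>A i Mod P i\<^esub> Y"
    have Z: "?Z \<in> carrier (A i Mod P i)"
      using X Y grp_Q[OF i] by (simp only: group.is_monoid monoid.m_closed)
    have "(SOME x. x \<in> X) \<otimes>\<^bsub>M\<^esub> (SOME x. x \<in> Y) \<in> ?Z"
      using some_in[OF i X] some_in[OF i Y] by (auto simp: set_mult_def)
    then have "g i (SOME x. x \<in> ?Z) y = g i ((SOME x. x \<in> X) \<otimes>\<^bsub>M\<^esub> (SOME x. x \<in> Y)) y"
      using g_cong1[OF i Z _ some_in[OF i Z] y] by blast
    also have "\<dots> = g i (SOME x. x \<in> X) y \<otimes>\<^bsub>QZ\<^esub> g i (SOME x. x \<in> Y) y"
      by (rule g_mult[OF i coset_in_F[OF i X some_in[OF i X]] coset_in_F[OF i Y some_in[OF i Y]] y])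
    finally show "g i (SOME x. x \<in> ?Z) y = g i (SOME x. x \<in> X) y \<otimes>\<^bsub>QZ\<^esub> g i (SOME x. x \<in> Y) y" .
  qed
qed

private lemma V_form_sym:
  assumes "v \<in> carrier (V_space M F p J)" "w \<in> carrier (V_space M F p J)"
  shows "V_form \<beta> p J v w = V_form \<beta> p J w v"
proof -
  have *: "(SOME x. x \<in> v i) \<in> F p i" "(SOME x. x \<in> w i) \<in> F p i" if "i \<in> J" for i
    using that assms by (metis V_component coset_in_F some_in)+
  then show ?thesis
    unfolding V_form_g by (intro QZ.gfinprod_cong) (auto simp: simp_implies_def g_closed g_sym)
qed

private lemma V_form_pow:
  assumes "v \<in> carrier (V_space M F p J)" "w \<in> carrier (V_space M F p J)"
  shows "V_form \<beta> p J v w [^]\<^bsub>QZ\<^esub> p = \<one>\<^bsub>QZ\<^esub>"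
proof -
  let ?f = "\<lambda>i. g i (SOME x. x \<in> v i) (SOME y. y \<in> w i)"
  have *: "(SOME x. x \<in> v i) \<in> F p i" "(SOME x. x \<in> w i) \<in> F p i" if "i \<in> J" for i
    using that assms by (metis V_component coset_in_F some_in)+
  have "finprod QZ ?f S [^]\<^bsub>QZ\<^esub> p = \<one>\<^bsub>QZ\<^esub>" if "finite S" "S \<subseteq> J" for S
    using that
  proof (induction S rule: finite_induct)
    case (insert i S)
    have cl: "?f \<in> S \<rightarrow> carrier QZ" "?f i \<in> carrier QZ"
      using insert.prems * by (auto intro!: g_closed)
    have "?f i [^]\<^bsub>QZ\<^esub> p = \<one>\<^bsub>QZ\<^esub>"
      using insert.prems * by (intro g_pow(1)) auto
    then show ?case
      using insert cl by (simp add: QZ.finprod_insert QZ.nat_pow_distrib QZ.finprod_closed)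
  qed simp
  then show ?thesis
    by (auto simp: V_form_g gfinprod_def)
qed

lemma V_form_symmetric_bilinear:
  "symmetric_bilinear_form (V_space M F p J) (inv_multiples_mod_Z p) (V_form \<beta> p J)"
proof -
  let ?V = "V_space M F p J" and ?W = "inv_multiples_mod_Z p"
  have grV: "group ?V" by (simp add: V_space_def grp_Q)
  have mult: "monoid.mult ?W = monoid.mult QZ" by (simp add: inv_multiples_mod_Z_def)
  have hom: "(\<lambda>v. V_form \<beta> p J v w) \<in> hom ?V ?W" if w: "w \<in> carrier ?V" for w
    using V_form_hom[OF w] V_form_pow[OF _ w]
    by (auto simp: hom_def mult carrier_inv_multiples_mod_Z)
  have "(\<lambda>w. V_form \<beta> p J v w) \<in> hom ?V ?W" if v: "v \<in> carrier ?V" for v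
    using hom[OF v] V_form_sym v grV
    by (auto simp: hom_def Pi_iff group.is_monoid monoid.m_closed)
  then show ?thesis
    using hom V_form_sym by (auto simp: symmetric_bilinear_form_def)
qed

end

end

theory Submission
  imports Defs
begin

text \<open>Write groups additively.  Since \<open>F p i\<close> is killed by \<open>p ^ i\<close>, the form vanishes on
  \<open>p\<^sup>a F p i \<times> p\<^sup>b F p j\<close> as soon as \<open>a + b \<ge> min i j\<close>.  Two subgroups of \<open>M\<close> organise the
  proof: \<open>lower\<close>, the sum of the \<open>p\<^sup>k F p i\<close> with \<open>k\<close> equal to \<open>i / 2\<close> rounded up, and \<open>upper\<close>,
  the same with rounding down.  They are orthogonal to each other, and their
  orders multiply to that of \<open>M\<close>.  A non-degenerate form satisfies \<open>|H| |H\<^sup>\<bottom>| = |M|\<close> for every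
  subgroup \<open>H\<close> (\<open>card_mult_perp\<close>), so then \<open>lower\<^sup>\<bottom> = upper\<close>.  The quotient \<open>upper / lower\<close> is killed
  by a product of distinct primes.  Hence, for a non-degenerate form, \<open>lower\<close> is one of the isotropic
  subgroups \<open>L\<close> with \<open>L\<^sup>\<bottom> / L\<close> semi-simple, and the question is when there is no other one.

  The spaces \<open>V\<close> live in the layers next to \<open>upper\<close>.  Sending \<open>x\<close> in \<open>F p i\<close> to \<open>p\<^sup>k x\<close>, where \<open>k\<close> is
  \<open>(i - 1) / 2\<close> rounded down, identifies the odd space with the \<open>p\<close>-torsion of \<open>upper / lower\<close>,
  its form being induced by \<open>\<beta>\<close>, and the even space with the quotient of
  \<open>{y. p y \<in> lower}\<close> by its intersection with \<open>upper\<close>, its form being induced by \<open>p \<beta>\<close>; the cross terms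
  between distinct \<open>i\<close> and \<open>j\<close> of the same parity vanish by the bound above.  So anisotropy
  for \<open>p\<close> reads (\<open>anisotropic_odd_iff\<close>, \<open>anisotropic_even_iff\<close>):

    \<^item> odd: if \<open>y \<in> upper\<close>, \<open>p y \<in> lower\<close> and \<open>\<beta> y y = 0\<close>, then \<open>y \<in> lower\<close>;
    \<^item> even: if \<open>p y \<in> lower\<close> and \<open>p \<beta> y y = 0\<close>, then \<open>y \<in> upper\<close>.

  Suppose that these hold for all \<open>p\<close>.  Non-degeneracy is tested on an element \<open>y\<close> of order \<open>p\<close> in
  the radical: its component with least \<open>i\<close> is some \<open>p\<^sup>i\<^sup>-\<^sup>1 x\<close>, and \<open>\<beta> y x = p\<^sup>i\<^sup>-\<^sup>1 \<beta> x x\<close> is the value of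
  the form on \<open>V\<close> at the class of \<open>x\<close>.  Next let \<open>L\<close> be isotropic with \<open>L\<^sup>\<bottom> / L\<close>
  semi-simple.  An element of \<open>L\<close> outside
  \<open>lower\<close> would have a multiple \<open>x\<close> outside \<open>lower\<close> with \<open>p x \<in> lower\<close>, which both criteria
  together exclude as \<open>\<beta> x x = 0\<close>.  So \<open>L \<subseteq> lower\<close>.  An element of \<open>L\<^sup>\<bottom>\<close> outside \<open>upper\<close> would have
  a multiple \<open>z\<close> outside \<open>upper\<close> with \<open>p z \<in> L\<close>, which the even criterion excludes as
  \<open>p \<beta> z z = \<beta> z (p z) = 0\<close>.  So \<open>L\<^sup>\<bottom> \<subseteq> upper\<close>, and taking orthogonals gives \<open>lower \<subseteq> L\<close>.

  Conversely a vector violating a criterion produces a second \<open>L\<close>: for the odd one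
  \<open>lower + \<langle>y\<rangle>\<close>, for the even one \<open>lower \<inter> y\<^sup>\<bottom>\<close>, whose orthogonal is \<open>upper + \<langle>y\<rangle>\<close>.\<close>

section \<open>Homomorphisms to $\mathbf{Q}/\mathbf{Z}$\<close>

lemma card_le_by_fibres:
  assumes "finite B" "f ` A \<subseteq> B"
    and "\<And>b. b \<in> B \<Longrightarrow> finite {a \<in> A. f a = b} \<and> card {a \<in> A. f a = b} \<le> m"
  shows "finite A \<and> card A \<le> card B * m"
proof -
  have A: "A = (\<Union>b\<in>B. {a \<in> A. f a = b})"
    using assms(2) by auto
  have "finite A"
    by (subst A) (use assms in auto)
  moreover have "card A \<le> (\<Sum>b\<in>B. card {a \<in> A. f a = b})"
    by (subst A) (rule card_UN_le[OF assms(1)])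
  moreover have "\<dots> \<le> (\<Sum>b\<in>B. m)"
    using assms(3) by (intro sum_mono) auto
  ultimately show ?thesis by auto
qed

lemma card_QZ_torsion:
  assumes "0 < k"
  shows "finite {c \<in> carrier QZ. c [^]\<^bsub>QZ\<^esub> k = \<one>\<^bsub>QZ\<^esub>}"
    and "card {c \<in> carrier QZ. c [^]\<^bsub>QZ\<^esub> k = \<one>\<^bsub>QZ\<^esub>} \<le> k"
proof -
  let ?f = "\<lambda>m::nat. \<int> #>\<^bsub>rat_group\<^esub> (of_nat m / of_nat k)"
  have "{c \<in> carrier QZ. c [^]\<^bsub>QZ\<^esub> k = \<one>\<^bsub>QZ\<^esub>} \<subseteq> ?f ` {..<k}"
  proof
    fix c assume "c \<in> {c \<in> carrier QZ. c [^]\<^bsub>QZ\<^esub> k = \<one>\<^bsub>QZ\<^esub>}"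
    then have "c \<in> carrier (inv_multiples_mod_Z k)"
      by (simp add: carrier_inv_multiples_mod_Z)
    then obtain r :: rat where r: "of_nat k * r \<in> \<int>" and c: "c = \<int> #>\<^bsub>rat_group\<^esub> r"
      by (auto simp: inv_multiples_mod_Z_def)
    from r obtain z where z: "of_nat k * r = of_int z"
      by (auto elim: Ints_cases)
    define m where "m = nat (z mod int k)"
    have m: "m < k" "int m = z mod int k"
      using assms by (auto simp: m_def nat_less_iff)
    have "z = int k * (z div int k) + int m"
      using m by simp
    then have "(of_int z :: rat) = of_nat k * of_int (z div int k) + of_nat m"
      by (metis of_int_add of_int_mult of_int_of_nat_eq)
    then have r': "r = of_int (z div int k) + of_nat m / of_nat k"
      using z assms by (simp add: field_simps)
    have "c = ?f m"
    proof -
      have "(\<exists>h\<in>\<int>. x = h + r) \<longleftrightarrow> (\<exists>h\<in>\<int>. x = h + of_nat m / (of_nat k :: rat))" for x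
      proof
        assume "\<exists>h\<in>\<int>. x = h + r"
        then obtain h where "h \<in> \<int>" "x = h + r" by auto
        then show "\<exists>h\<in>\<int>. x = h + of_nat m / (of_nat k :: rat)"
          by (intro bexI[of _ "h + of_int (z div int k)"]) (auto simp: r')
      next
        assume "\<exists>h\<in>\<int>. x = h + of_nat m / (of_nat k :: rat)"
        then obtain h where "h \<in> \<int>" "x = h + of_nat m / (of_nat k :: rat)" by auto
        then show "\<exists>h\<in>\<int>. x = h + r"
          by (intro bexI[of _ "h - of_int (z div int k)"]) (auto simp: r')
      qed
      then show ?thesis
        by (auto simp: c r_coset_def rat_group_def)
    qed
    then show "c \<in> ?f ` {..<k}" using m by auto
  qed
  then show "finite {c \<in> carrier QZ. c [^]\<^bsub>QZ\<^esub> k = \<one>\<^bsub>QZ\<^esub>}"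
    and "card {c \<in> carrier QZ. c [^]\<^bsub>QZ\<^esub> k = \<one>\<^bsub>QZ\<^esub>} \<le> k"
    using finite_surj[of "{..<k}" _ ?f] surj_card_le[of "{..<k}" _ ?f] by auto
qed

text \<open>The powers have natural exponents, which is enough to get a subgroup when \<open>G\<close> is finite.\<close>

definition adjoin :: "('a, 'b) monoid_scheme \<Rightarrow> 'a set \<Rightarrow> 'a \<Rightarrow> 'a set"
  where "adjoin G N x = {n \<otimes>\<^bsub>G\<^esub> x [^]\<^bsub>G\<^esub> (k::nat) |n k. n \<in> N}"

context comm_group
begin

lemma adjoin_supset:
  assumes "subgroup N G" "x \<in> carrier G"
  shows "N \<subseteq> adjoin G N x" and "x \<in> adjoin G N x"
proof -
  show "N \<subseteq> adjoin G N x"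
  proof
    fix n assume "n \<in> N"
    then show "n \<in> adjoin G N x"
      unfolding adjoin_def using subgroup.mem_carrier[OF assms(1)]
      by (auto intro!: exI[of _ n] exI[of _ "0::nat"])
  qed
  show "x \<in> adjoin G N x"
    unfolding adjoin_def using assms subgroup.one_closed[OF assms(1)]
    by (auto intro!: exI[of _ \<one>] exI[of _ "1::nat"])
qed

lemma adjoin_subgroup:
  assumes N: "subgroup N G" and x: "x \<in> carrier G" and fin: "finite (carrier G)"
  shows "subgroup (adjoin G N x) G"
proof -
  have N_in: "n \<in> carrier G" if "n \<in> N" for n
    using that subgroup.mem_carrier[OF N] by simp
  show ?thesis
  proof (rule subgroupI)
    show "adjoin G N x \<subseteq> carrier G"
      using N_in x by (auto simp: adjoin_def)
    show "adjoin G N x \<noteq> {}"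
      using adjoin_supset[OF N x] by auto
  next
    fix a assume "a \<in> adjoin G N x"
    then obtain n k where a: "n \<in> N" "a = n \<otimes> x [^] (k::nat)"
      by (auto simp: adjoin_def)
    define c where "c = card (carrier G)"
    have "c > 0"
      using fin x by (auto simp: c_def card_gt_0_iff)
    have "x [^] k \<otimes> x [^] (k * (c - 1)) = x [^] (c * k)"
      using x \<open>c > 0\<close> by (cases c) (simp_all add: nat_pow_mult algebra_simps)
    also have "\<dots> = \<one>"
      using x power_order_eq_one[OF fin x] by (simp add: c_def nat_pow_pow[symmetric])
    finally have "inv (x [^] k) = x [^] (k * (c - 1))"
      using x by (metis inv_equality m_comm nat_pow_closed)
    then have "inv a = inv n \<otimes> x [^] (k * (c - 1))"
      using a N_in x by (simp add: inv_mult)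
    then show "inv a \<in> adjoin G N x"
      using subgroup.m_inv_closed[OF N a(1)] by (auto simp: adjoin_def)
  next
    fix a b assume "a \<in> adjoin G N x" "b \<in> adjoin G N x"
    then obtain n k n' k' where ab: "n \<in> N" "a = n \<otimes> x [^] (k::nat)" "n' \<in> N" "b = n' \<otimes> x [^] (k'::nat)"
      by (auto simp: adjoin_def)
    have "a \<otimes> b = (n \<otimes> n') \<otimes> x [^] (k + k')"
      using ab N_in x by (simp add: m_ac nat_pow_mult[symmetric])
    then show "a \<otimes> b \<in> adjoin G N x"
      using subgroup.m_closed[OF N ab(1,3)] by (auto simp: adjoin_def)
  qed
qed

lemma card_adjoin_ge:
  assumes N: "subgroup N G" and x: "x \<in> carrier G" and fin: "finite (carrier G)"
    and k: "\<And>j. 0 < j \<Longrightarrow> j < k \<Longrightarrow> x [^] j \<notin> N"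
  shows "k * card N \<le> card (adjoin G N x)"
proof -
  have N_in: "n \<in> carrier G" if "n \<in> N" for n
    using that subgroup.mem_carrier[OF N] by simp
  have eq: "j = j' \<and> n = n'"
    if "n \<in> N" "n' \<in> N" "j \<le> j'" "j' < k" "n \<otimes> x [^] j = n' \<otimes> x [^] j'" for n n' j j'
  proof -
    have "n \<otimes> x [^] j = n' \<otimes> x [^] (j' - j) \<otimes> x [^] j"
      using that N_in x by (simp add: m_assoc nat_pow_mult)
    then have n: "n = n' \<otimes> x [^] (j' - j)"
      using that N_in x by simp
    then have "x [^] (j' - j) = inv n' \<otimes> n"
      using that N_in x by (simp add: m_assoc[symmetric])
    then have "x [^] (j' - j) \<in> N"
      using that by (simp add: subgroup.m_closed[OF N] subgroup.m_inv_closed[OF N])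
    then have "j' - j = 0"
      using k[of "j' - j"] that by fastforce
    then show ?thesis using that n N_in by auto
  qed
  have inj: "inj_on (\<lambda>(j, n). n \<otimes> x [^] j) ({..<k} \<times> N)"
  proof (rule inj_onI, clarsimp)
    fix j n j' n' assume *: "n \<in> N" "n' \<in> N" "j < k" "j' < k" "n \<otimes> x [^] j = n' \<otimes> x [^] j'"
    show "j = j' \<and> n = n'"
      using eq[of n n' j j'] eq[of n' n j' j] * by (cases "j \<le> j'") auto
  qed
  have sub: "(\<lambda>(j, n). n \<otimes> x [^] j) ` ({..<k} \<times> N) \<subseteq> adjoin G N x"
    by (auto simp: adjoin_def)
  have "finite (adjoin G N x)"
    using adjoin_subgroup[OF N x fin] fin by (meson finite_subset subgroup.subset)
  from card_mono[OF this sub] show ?thesis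
    by (simp add: card_image[OF inj] card_cartesian_product)
qed

lemma subgroup_nat_pow_closed:
  assumes "subgroup H G" "x \<in> H"
  shows "x [^] (n::nat) \<in> H"
  by (induction n) (use assms in \<open>auto intro: subgroup.one_closed subgroup.m_closed\<close>)

end

definition QZ_annihilator :: "('a, 'b) monoid_scheme \<Rightarrow> 'a set \<Rightarrow> ('a \<Rightarrow> rat set) set"
  where "QZ_annihilator G N = {f \<in> hom G QZ \<inter> extensional (carrier G). \<forall>n\<in>N. f n = \<one>\<^bsub>QZ\<^esub>}"

text \<open>The homomorphisms that kill \<open>N\<close> are the characters of \<open>G / N\<close>, and there are no more of them than
  elements.  One enlarges \<open>N\<close> by one element \<open>x\<close> at a time: if \<open>k\<close> is the order of \<open>x\<close> modulo \<open>N\<close>,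
  the value at \<open>x\<close> is one of the \<open>k\<close> elements of $\mathbf{Q}/\mathbf{Z}$ killed by \<open>k\<close>, and the
  homomorphisms with a given value at \<open>x\<close> differ by ones that kill the larger subgroup, whose
  order is at least \<open>k |N|\<close>.\<close>

lemma (in comm_group) card_QZ_annihilator:
  assumes fin: "finite (carrier G)" and N: "subgroup N G"
  shows "finite (QZ_annihilator G N) \<and> card (QZ_annihilator G N) * card N \<le> card (carrier G)"
  using N
proof (induction "card (carrier G) - card N" arbitrary: N rule: less_induct)
  case less
  note N = \<open>subgroup N G\<close>
  have N_in: "N \<subseteq> carrier G" using subgroup.subset[OF N] .
  have finN: "finite N" using N_in fin finite_subset by auto
  show ?case
  proof (cases "N = carrier G")
    case True
    have "QZ_annihilator G N \<subseteq> {\<lambda>x\<in>carrier G. \<one>\<^bsub>QZ\<^esub>}"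
      unfolding QZ_annihilator_def True by (auto simp: extensional_def fun_eq_iff)
    then have "finite (QZ_annihilator G N)" "card (QZ_annihilator G N) \<le> 1"
      using finite_subset card_mono[of "{\<lambda>x\<in>carrier G. \<one>\<^bsub>QZ\<^esub>}"] by auto
    then show ?thesis using True by simp
  next
    case False
    then obtain x where x: "x \<in> carrier G" "x \<notin> N" using N_in by auto
    define k where "k = (LEAST k. 0 < k \<and> x [^] (k::nat) \<in> N)"
    have "0 < card (carrier G) \<and> x [^] card (carrier G) \<in> N"
      using power_order_eq_one[OF fin x(1)] fin x subgroup.one_closed[OF N]
      by (auto simp: card_gt_0_iff)
    then have k: "0 < k" "x [^] k \<in> N"
      unfolding k_def by (metis (mono_tags, lifting) LeastI)+
    have k_least: "x [^] j \<notin> N" if "0 < j" "j < k" for j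
      using that not_less_Least[of j "\<lambda>k. 0 < k \<and> x [^] (k::nat) \<in> N"] by (auto simp: k_def)
    let ?N' = "adjoin G N x"
    have N': "subgroup ?N' G" by (rule adjoin_subgroup[OF N x(1) fin])
    have N'_in: "?N' \<subseteq> carrier G" using subgroup.subset[OF N'] .
    have finN': "finite ?N'" using N'_in fin finite_subset by auto
    have "N \<subset> ?N'" using adjoin_supset[OF N x(1)] x(2) by auto
    then have "card N < card ?N'" by (rule psubset_card_mono[OF finN'])
    moreover have "card ?N' \<le> card (carrier G)" by (rule card_mono[OF fin N'_in])
    ultimately have "card (carrier G) - card ?N' < card (carrier G) - card N" by linarith
    from less.hyps[OF this N'] have IH: "finite (QZ_annihilator G ?N')"
      "card (QZ_annihilator G ?N') * card ?N' \<le> card (carrier G)" by auto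
    let ?T = "{c \<in> carrier QZ. c [^]\<^bsub>QZ\<^esub> k = \<one>\<^bsub>QZ\<^esub>}"
    have hom: "f \<in> hom G QZ" if "f \<in> QZ_annihilator G N" for f
      using that by (auto simp: QZ_annihilator_def)
    have closed: "f y \<in> carrier QZ" if "f \<in> QZ_annihilator G N" "y \<in> carrier G" for f y
      using hom_carrier[OF hom[OF that(1)]] that(2) by auto
    have "f x \<in> ?T" if f: "f \<in> QZ_annihilator G N" for f
    proof -
      have "f x [^]\<^bsub>QZ\<^esub> k = f (x [^] k)"
        using hom_nat_pow[OF hom[OF f] x(1) is_group QZ.is_group] by simp
      then show ?thesis
        using f k x closed by (auto simp: QZ_annihilator_def)
    qed
    then have img: "(\<lambda>f. f x) ` QZ_annihilator G N \<subseteq> ?T" by auto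
    \<comment> \<open>Two homomorphisms in the same fibre differ by one that kills \<open>x\<close> as well.\<close>
    have "finite {f \<in> QZ_annihilator G N. f x = c} \<and>
          card {f \<in> QZ_annihilator G N. f x = c} \<le> card (QZ_annihilator G ?N')" for c
    proof (cases "{f \<in> QZ_annihilator G N. f x = c} = {}")
      case True
      show ?thesis unfolding True by simp
    next
      case False
      then obtain h where h: "h \<in> QZ_annihilator G N" "h x = c" by auto
      let ?d = "\<lambda>f. \<lambda>y\<in>carrier G. f y \<otimes>\<^bsub>QZ\<^esub> inv\<^bsub>QZ\<^esub> h y"
      have inj: "inj_on ?d {f \<in> QZ_annihilator G N. f x = c}"
      proof (rule inj_onI)
        fix f f' assume f: "f \<in> {f \<in> QZ_annihilator G N. f x = c}"
          and f': "f' \<in> {f \<in> QZ_annihilator G N. f x = c}" and eq: "?d f = ?d f'"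
        show "f = f'"
        proof (rule extensionalityI[of _ "carrier G"])
          show "f \<in> extensional (carrier G)" "f' \<in> extensional (carrier G)"
            using f f' by (auto simp: QZ_annihilator_def)
          fix y assume y: "y \<in> carrier G"
          have "f y \<otimes>\<^bsub>QZ\<^esub> inv\<^bsub>QZ\<^esub> h y = f' y \<otimes>\<^bsub>QZ\<^esub> inv\<^bsub>QZ\<^esub> h y"
            using fun_cong[OF eq, of y] y by simp
          then show "f y = f' y"
            using f f' y closed h by simp
        qed
      qed
      have "?d f \<in> QZ_annihilator G ?N'" if f: "f \<in> QZ_annihilator G N" "f x = c" for f
      proof -
        have d_hom: "?d f \<in> hom G QZ"
        proof (rule homI)
          fix y z assume yz: "y \<in> carrier G" "z \<in> carrier G"
          then show "?d f (y \<otimes> z) = ?d f y \<otimes>\<^bsub>QZ\<^esub> ?d f z"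
            using hom_mult[OF hom[OF f(1)]] hom_mult[OF hom[OF h(1)]] closed[OF f(1)] closed[OF h(1)]
            by (simp add: QZ.inv_mult QZ.m_ac)
        qed (use closed f h in auto)
        have kill: "?d f n = \<one>\<^bsub>QZ\<^esub>" if "n \<in> N" for n
          using that f h N_in by (auto simp: QZ_annihilator_def)
        have "?d f x = \<one>\<^bsub>QZ\<^esub>"
          using f h x QZ.r_inv[OF closed[OF h(1) x(1)]] by simp
        then have "?d f (x [^] j) = \<one>\<^bsub>QZ\<^esub>" for j :: nat
          using hom_nat_pow[OF d_hom x(1) is_group QZ.is_group, of j] by simp
        then have "?d f (n \<otimes> x [^] j) = \<one>\<^bsub>QZ\<^esub>" if "n \<in> N" for n and j :: nat
          using hom_mult[OF d_hom, of n "x [^] j"] kill[OF that] that N_in x by auto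
        then have "\<forall>n\<in>?N'. ?d f n = \<one>\<^bsub>QZ\<^esub>"
          unfolding adjoin_def by blast
        then show ?thesis
          unfolding QZ_annihilator_def using d_hom by simp
      qed
      then have "?d ` {f \<in> QZ_annihilator G N. f x = c} \<subseteq> QZ_annihilator G ?N'" by auto
      then show ?thesis
        using IH(1) inj by (meson card_inj_on_le inj_on_finite)
    qed
    then have "finite (QZ_annihilator G N) \<and>
        card (QZ_annihilator G N) \<le> card ?T * card (QZ_annihilator G ?N')"
      using card_le_by_fibres[OF card_QZ_torsion(1)[OF k(1)] img] by blast
    then have bound: "finite (QZ_annihilator G N)"
        "card (QZ_annihilator G N) \<le> k * card (QZ_annihilator G ?N')"
      using card_QZ_torsion(2)[OF k(1)] by (auto intro: order_trans mult_le_mono1)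
    have "card (QZ_annihilator G N) * card N \<le> (k * card (QZ_annihilator G ?N')) * card N"
      using bound by simp
    also have "\<dots> = card (QZ_annihilator G ?N') * (k * card N)" by simp
    also have "\<dots> \<le> card (QZ_annihilator G ?N') * card ?N'"
      using card_adjoin_ge[OF N x(1) fin k_least] by simp
    also note IH(2)
    finally show ?thesis using bound by simp
  qed
qed

section \<open>Powers, subgroups and semi-simple quotients\<close>

context comm_group
begin

text \<open>By Bezout \<open>x\<close> is a combination of its two multiples.\<close>

lemma mem_subgroup_if_coprime_pows:
  assumes S: "subgroup S G" and x: "x \<in> carrier G" and "x [^] (m::nat) \<in> S" "x [^] (n::nat) \<in> S"
    and mn: "coprime m n"
  shows "x \<in> S"
proof (cases "m = 0")
  case True
  then show ?thesis using assms by simp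
next
  case False
  then obtain u v where uv: "m * u = n * v + 1"
    using bezout_nat[of m n] mn by auto
  have "x [^] (m * u) \<in> S" "x [^] (n * v) \<in> S"
    using assms subgroup_nat_pow_closed[OF S] by (simp_all add: nat_pow_pow[symmetric])
  moreover have "x = inv (x [^] (n * v)) \<otimes> x [^] (m * u)"
    using x by (simp add: uv m_assoc[symmetric])
  ultimately show ?thesis
    using subgroup.m_closed[OF S] subgroup.m_inv_closed[OF S] by metis
qed

text \<open>The quotient of \<open>H\<close> by \<open>H \<inter> S\<close> is a non-trivial finite group, so it has elements of prime order.\<close>

lemma prime_pow_mem_if_not_subset:
  assumes fin: "finite (carrier G)" and H: "subgroup H G" and S: "subgroup S G" and "\<not> H \<subseteq> S"
  obtains x p where "x \<in> H" "x \<notin> S" "Factorial_Ring.prime (p::nat)" "x [^] p \<in> S"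
proof -
  obtain y where y: "y \<in> H" "y \<notin> S" using assms by auto
  then have y_in: "y \<in> carrier G" using subgroup.mem_carrier[OF H] by auto
  define n where "n = (LEAST n. 0 < n \<and> y [^] (n::nat) \<in> S)"
  have "0 < card (carrier G) \<and> y [^] card (carrier G) \<in> S"
    using power_order_eq_one[OF fin y_in] fin y_in subgroup.one_closed[OF S]
    by (auto simp: card_gt_0_iff)
  then have n: "0 < n" "y [^] n \<in> S"
    unfolding n_def by (metis (mono_tags, lifting) LeastI)+
  have least: "y [^] j \<notin> S" if "0 < j" "j < n" for j
    using that not_less_Least[of j "\<lambda>n. 0 < n \<and> y [^] (n::nat) \<in> S"] by (auto simp: n_def)
  have "n \<noteq> 1" using n y y_in by auto
  then obtain p where p: "Factorial_Ring.prime p" "p dvd n"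
    using prime_factor_nat by auto
  then obtain m where m: "n = m * p" by (metis dvd_div_mult_self)
  have "y [^] m \<notin> S"
    using least[of m] m n p prime_gt_1_nat[OF p(1)] by auto
  moreover have "(y [^] m) [^] p \<in> S"
    using n y_in by (simp add: nat_pow_pow m)
  moreover have "y [^] m \<in> H"
    using subgroup_nat_pow_closed[OF H y(1)] .
  ultimately show thesis using that p by blast
qed

lemma group_exponent_dvd:
  assumes "0 < d" "\<And>x. x \<in> carrier G \<Longrightarrow> x [^] d = \<one>"
  shows "group_exponent G dvd d" and "x \<in> carrier G \<Longrightarrow> x [^] group_exponent G = \<one>"
proof -
  let ?P = "\<lambda>n::nat. 0 < n \<and> (\<forall>x\<in>carrier G. x [^] n = \<one>)"
  let ?e = "group_exponent G"
  have e: "?P ?e"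
    unfolding group_exponent_def by (rule LeastI[of ?P d]) (use assms in auto)
  then show "x \<in> carrier G \<Longrightarrow> x [^] ?e = \<one>" by simp
  have "x [^] (d mod ?e) = \<one>" if x: "x \<in> carrier G" for x
  proof -
    have "x [^] (?e * (d div ?e)) = \<one>"
      using x e by (simp add: nat_pow_pow[symmetric])
    moreover have "x [^] (?e * (d div ?e)) \<otimes> x [^] (d mod ?e) = x [^] d"
      using x by (simp add: nat_pow_mult)
    ultimately show ?thesis
      using x assms(2)[OF x] by simp
  qed
  moreover have "\<not> ?P (d mod ?e)"
    using not_less_Least[of "d mod ?e" ?P] e by (simp add: group_exponent_def)
  ultimately show "?e dvd d" by auto
qed

text \<open>A number killing a group is a multiple of the exponent, and divisors of squarefree numbers are
  squarefree; so the exponent may be replaced by any squarefree number that kills the quotient.\<close>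

lemma semisimple_quotient_iff:
  assumes fin: "finite (carrier G)" and L: "subgroup L G" and H: "subgroup H G" and LH: "L \<subseteq> H"
  shows "semisimple_group (G\<lparr>carrier := H\<rparr> Mod L) \<longleftrightarrow> (\<exists>d::nat. squarefree d \<and> (\<forall>x\<in>H. x [^] d \<in> L))"
proof -
  let ?H = "G\<lparr>carrier := H\<rparr>" and ?Q = "G\<lparr>carrier := H\<rparr> Mod L"
  interpret H: group ?H by (rule subgroup_imp_group[OF H])
  interpret H: comm_group ?H
    by (rule H.group_comm_groupI) (use subgroup.mem_carrier[OF H] m_comm in auto)
  have LH': "subgroup L ?H" by (rule subgroup_incl[OF L H LH])
  interpret L: normal L ?H
    using H.normal_iff_subgroup LH' by simp
  interpret Q: comm_group ?Q
    by (rule H.abelian_FactGroup[OF LH'])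
  have pow: "(L #>\<^bsub>?H\<^esub> x) [^]\<^bsub>?Q\<^esub> (n::nat) = \<one>\<^bsub>?Q\<^esub> \<longleftrightarrow> x [^] n \<in> L" if x: "x \<in> H" for x n
  proof -
    have xn: "x [^] n \<in> H" using subgroup_nat_pow_closed[OF H x] .
    have "(L #>\<^bsub>?H\<^esub> x) [^]\<^bsub>?Q\<^esub> n = L #>\<^bsub>?H\<^esub> (x [^] n)"
      using L.FactGroup_pow[of x n] x by (simp add: nat_pow_consistent[symmetric])
    moreover have "L #>\<^bsub>?H\<^esub> (x [^] n) = L \<longleftrightarrow> x [^] n \<in> L"
      using H.coset_join1[OF _ _ LH', of "x [^] n"] H.coset_join2[OF _ LH', of "x [^] n"] xn
      by auto
    ultimately show ?thesis by simp
  qed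
  have kill: "(\<forall>X\<in>carrier ?Q. X [^]\<^bsub>?Q\<^esub> n = \<one>\<^bsub>?Q\<^esub>) \<longleftrightarrow> (\<forall>x\<in>H. x [^] n \<in> L)" for n :: nat
    using pow by (auto simp: carrier_FactGroup simp del: one_FactGroup)
  show ?thesis
  proof
    assume ss: "semisimple_group ?Q"
    have "0 < card (carrier G)"
      using fin by (auto simp: card_gt_0_iff)
    moreover have "\<forall>x\<in>H. x [^] card (carrier G) \<in> L"
      using power_order_eq_one[OF fin] subgroup.mem_carrier[OF H] subgroup.one_closed[OF L] by auto
    then have "X [^]\<^bsub>?Q\<^esub> card (carrier G) = \<one>\<^bsub>?Q\<^esub>" if "X \<in> carrier ?Q" for X
      using kill that by blast
    ultimately have "\<forall>X\<in>carrier ?Q. X [^]\<^bsub>?Q\<^esub> group_exponent ?Q = \<one>\<^bsub>?Q\<^esub>"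
      using Q.group_exponent_dvd(2) by blast
    then show "\<exists>d::nat. squarefree d \<and> (\<forall>x\<in>H. x [^] d \<in> L)"
      using ss kill[of "group_exponent ?Q"] unfolding semisimple_group_def by blast
  next
    assume "\<exists>d::nat. squarefree d \<and> (\<forall>x\<in>H. x [^] d \<in> L)"
    then obtain d :: nat where d: "squarefree d" "\<forall>x\<in>H. x [^] d \<in> L" by blast
    have "0 < d" using d(1) by (cases "d = 0") auto
    then have "group_exponent ?Q dvd d"
      using Q.group_exponent_dvd(1)[of d] kill[of d] d(2) by blast
    then show "semisimple_group ?Q"
      unfolding semisimple_group_def using d(1) squarefree_mono by blast
  qed
qed

end


section \<open>Orthogonal subgroups\<close>

locale finite_bilinear_group = comm_group M for M (structure) +
  fixes \<beta> :: "'a \<Rightarrow> 'a \<Rightarrow> rat set"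
  assumes fin: "finite (carrier M)" and form: "symmetric_bilinear_form M QZ \<beta>"
begin

lemma form_closed [simp]: "x \<in> carrier M \<Longrightarrow> y \<in> carrier M \<Longrightarrow> \<beta> x y \<in> carrier QZ"
  using form by (auto simp: symmetric_bilinear_form_def hom_def)

lemma form_sym: "x \<in> carrier M \<Longrightarrow> y \<in> carrier M \<Longrightarrow> \<beta> x y = \<beta> y x"
  using form by (auto simp: symmetric_bilinear_form_def)

lemma form_hom_left: "y \<in> carrier M \<Longrightarrow> (\<lambda>x. \<beta> x y) \<in> hom M QZ"
  using form by (auto simp: symmetric_bilinear_form_def)

lemma form_hom_right: "x \<in> carrier M \<Longrightarrow> (\<lambda>y. \<beta> x y) \<in> hom M QZ"
  using form by (auto simp: symmetric_bilinear_form_def)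

lemma form_mult_left:
  "x \<in> carrier M \<Longrightarrow> x' \<in> carrier M \<Longrightarrow> y \<in> carrier M \<Longrightarrow> \<beta> (x \<otimes> x') y = \<beta> x y \<otimes>\<^bsub>QZ\<^esub> \<beta> x' y"
  using hom_mult[OF form_hom_left] by simp

lemma form_mult_right:
  "x \<in> carrier M \<Longrightarrow> y \<in> carrier M \<Longrightarrow> y' \<in> carrier M \<Longrightarrow> \<beta> x (y \<otimes> y') = \<beta> x y \<otimes>\<^bsub>QZ\<^esub> \<beta> x y'"
  using hom_mult[OF form_hom_right] by simp

lemma form_pow_left:
  "x \<in> carrier M \<Longrightarrow> y \<in> carrier M \<Longrightarrow> \<beta> (x [^] (n::nat)) y = \<beta> x y [^]\<^bsub>QZ\<^esub> n"
  using hom_nat_pow[OF form_hom_left _ is_group QZ.is_group] by simp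

lemma form_pow_right:
  "x \<in> carrier M \<Longrightarrow> y \<in> carrier M \<Longrightarrow> \<beta> x (y [^] (n::nat)) = \<beta> x y [^]\<^bsub>QZ\<^esub> n"
  using hom_nat_pow[OF form_hom_right _ is_group QZ.is_group] by simp

lemma form_one_left [simp]: "y \<in> carrier M \<Longrightarrow> \<beta> \<one> y = \<one>\<^bsub>QZ\<^esub>"
  using form_pow_left[of \<one> y 0] by simp

lemma form_one_right [simp]: "x \<in> carrier M \<Longrightarrow> \<beta> x \<one> = \<one>\<^bsub>QZ\<^esub>"
  using form_pow_right[of x \<one> 0] by simp

lemma form_inv_left: "x \<in> carrier M \<Longrightarrow> y \<in> carrier M \<Longrightarrow> \<beta> (inv x) y = inv\<^bsub>QZ\<^esub> \<beta> x y"
  by (rule QZ.inv_equality[symmetric]) (simp_all flip: form_mult_left)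

lemma finite_subset_carrier: "H \<subseteq> carrier M \<Longrightarrow> finite H"
  using fin finite_subset by blast

lemma perp_subset: "perp M \<beta> H \<subseteq> carrier M"
  by (auto simp: perp_def)

lemma perp_antimono: "H \<subseteq> H' \<Longrightarrow> perp M \<beta> H' \<subseteq> perp M \<beta> H"
  by (auto simp: perp_def)

lemma subset_perp_swap:
  assumes "H \<subseteq> carrier M" "H \<subseteq> perp M \<beta> H'" "H' \<subseteq> carrier M"
  shows "H' \<subseteq> perp M \<beta> H"
proof
  fix x assume x: "x \<in> H'"
  have "\<beta> x h = \<one>\<^bsub>QZ\<^esub>" if "h \<in> H" for h
    using assms x that form_sym[of x h] by (simp add: perp_def subset_iff)
  then show "x \<in> perp M \<beta> H"
    using assms x by (simp add: perp_def subset_iff)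
qed

lemma subgroup_perp:
  assumes "H \<subseteq> carrier M"
  shows "subgroup (perp M \<beta> H) M"
proof (rule subgroupI)
  show "perp M \<beta> H \<noteq> {}"
    using assms by (simp add: perp_def set_eq_iff subset_iff exI[of _ \<one>])
next
  fix a b assume ab: "a \<in> perp M \<beta> H" "b \<in> perp M \<beta> H"
  then show "a \<otimes> b \<in> perp M \<beta> H"
    using assms by (simp add: perp_def form_mult_left subset_iff)
  show "inv a \<in> perp M \<beta> H"
    using ab assms by (simp add: perp_def form_inv_left subset_iff)
qed (rule perp_subset)

lemma perp_adjoin:
  assumes "H \<subseteq> carrier M" "subgroup H M" "x \<in> carrier M" "y \<in> perp M \<beta> H" "\<beta> y x = \<one>\<^bsub>QZ\<^esub>"
  shows "y \<in> perp M \<beta> (adjoin M H x)"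
proof -
  have "\<beta> y (h \<otimes> x [^] k) = \<one>\<^bsub>QZ\<^esub>" if "h \<in> H" for h and k :: nat
    using assms that by (simp add: perp_def form_mult_right form_pow_right subset_iff)
  then show ?thesis
    using assms(4) unfolding perp_def adjoin_def by blast
qed

text \<open>\<open>perp M \<beta> H\<close> is the kernel of the map from \<open>M\<close> to the characters of \<open>H\<close>, which are at most as many
  as the elements of \<open>H\<close>.\<close>

lemma card_le_card_mult_perp:
  assumes H: "subgroup H M"
  shows "card (carrier M) \<le> card H * card (perp M \<beta> H)"
proof -
  let ?H = "M\<lparr>carrier := H\<rparr>" and ?f = "\<lambda>m. \<lambda>h\<in>H. \<beta> m h"
  have H_in: "h \<in> carrier M" if "h \<in> H" for h
    using that subgroup.mem_carrier[OF H] by simp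
  interpret H: group ?H by (rule subgroup_imp_group[OF H])
  interpret H: comm_group ?H
    by (rule H.group_comm_groupI) (use H_in m_comm in auto)
  have finH: "finite H" using finite_subset_carrier H_in by blast
  let ?A = "QZ_annihilator ?H {\<one>}"
  have "subgroup {\<one>} ?H"
    using H.triv_subgroup by simp
  then have A: "finite ?A" "card ?A \<le> card H"
    using H.card_QZ_annihilator[of "{\<one>}"] finH by auto
  have "?f m \<in> hom ?H QZ" if "m \<in> carrier M" for m
    using that by (intro homI) (auto simp: H_in form_mult_right subgroup.m_closed[OF H])
  then have img: "?f ` carrier M \<subseteq> ?A"
    using subgroup.one_closed[OF H] by (simp add: QZ_annihilator_def image_subset_iff)
  have "finite {m \<in> carrier M. ?f m = g} \<and> card {m \<in> carrier M. ?f m = g} \<le> card (perp M \<beta> H)" for g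
  proof (cases "{m \<in> carrier M. ?f m = g} = {}")
    case True
    show ?thesis unfolding True by simp
  next
    case False
    then obtain m0 where m0: "m0 \<in> carrier M" "?f m0 = g" by auto
    have "inj_on (\<lambda>m. m \<otimes> inv m0) {m \<in> carrier M. ?f m = g}"
      using m0 by (auto intro!: inj_onI)
    moreover have "m \<otimes> inv m0 \<in> perp M \<beta> H" if m: "m \<in> carrier M" "?f m = g" for m
    proof -
      have "\<beta> m h = \<beta> m0 h" if "h \<in> H" for h
        using fun_cong[OF trans[OF m(2) m0(2)[symmetric]], of h] that by simp
      then show ?thesis
        using m m0 H_in by (simp add: perp_def form_mult_left form_inv_left)
    qed
    then have "(\<lambda>m. m \<otimes> inv m0) ` {m \<in> carrier M. ?f m = g} \<subseteq> perp M \<beta> H" by auto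
    ultimately show ?thesis
      using finite_subset_carrier[OF perp_subset] by (meson card_inj_on_le inj_on_finite)
  qed
  then have "card (carrier M) \<le> card ?A * card (perp M \<beta> H)"
    using card_le_by_fibres[OF A(1) img] by blast
  also have "\<dots> \<le> card H * card (perp M \<beta> H)"
    using A(2) by (rule mult_le_mono1)
  finally show ?thesis .
qed

lemma restrict_form_hom:
  "m \<in> carrier M \<Longrightarrow> (\<lambda>m'\<in>carrier M. \<beta> m m') \<in> hom M QZ \<inter> extensional (carrier M)"
  by (auto simp: form_mult_right intro!: homI)

lemma inj_on_form_if_radical_trivial:
  assumes "perp M \<beta> (carrier M) = {\<one>}"
  shows "inj_on (\<lambda>m. \<lambda>m'\<in>carrier M. \<beta> m m') (carrier M)"
proof (rule inj_onI)
  fix x y assume xy: "x \<in> carrier M" "y \<in> carrier M"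
    and eq: "(\<lambda>m'\<in>carrier M. \<beta> x m') = (\<lambda>m'\<in>carrier M. \<beta> y m')"
  have "\<beta> x z = \<beta> y z" if "z \<in> carrier M" for z
    using fun_cong[OF eq, of z] that by simp
  then have "x \<otimes> inv y \<in> perp M \<beta> (carrier M)"
    using xy by (simp add: perp_def form_mult_left form_inv_left)
  then have "x \<otimes> inv y = \<one>" using assms by simp
  then show "x = y" using xy by (metis inv_closed inv_equality inv_inv)
qed

text \<open>Injectivity of \<open>M \<rightarrow> Hom(M, \<^bold>Q/\<^bold>Z)\<close> suffices, because the target has at most as many elements as \<open>M\<close>.\<close>

lemma nondegenerate_iff_radical_trivial: "nondegenerate M \<beta> \<longleftrightarrow> perp M \<beta> (carrier M) = {\<one>}"
proof
  assume "nondegenerate M \<beta>"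
  then have inj: "inj_on (\<lambda>m. \<lambda>m'\<in>carrier M. \<beta> m m') (carrier M)"
    by (auto simp: nondegenerate_def iso_def bij_betw_def)
  show "perp M \<beta> (carrier M) = {\<one>}"
  proof (intro equalityI subsetI)
    fix x assume x: "x \<in> perp M \<beta> (carrier M)"
    then have "(\<lambda>m'\<in>carrier M. \<beta> x m') = (\<lambda>m'\<in>carrier M. \<beta> \<one> m')"
      by (intro restrict_ext) (simp add: perp_def)
    then show "x \<in> {\<one>}"
      using inj_onD[OF inj, of x \<one>] x by (auto simp: perp_def)
  qed (auto simp: perp_def)
next
  assume rad: "perp M \<beta> (carrier M) = {\<one>}"
  let ?f = "\<lambda>m. \<lambda>m'\<in>carrier M. \<beta> m m'"
  let ?A = "hom M QZ \<inter> extensional (carrier M)"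
  have "QZ_annihilator M {\<one>} = ?A"
    using hom_one[OF _ is_group QZ.is_group] by (auto simp: QZ_annihilator_def)
  then have A: "finite ?A" "card ?A \<le> card (carrier M)"
    using card_QZ_annihilator[OF fin triv_subgroup] by auto
  have inj: "inj_on ?f (carrier M)" by (rule inj_on_form_if_radical_trivial[OF rad])
  have img: "?f ` carrier M \<subseteq> ?A"
    using restrict_form_hom by auto
  have "?f ` carrier M = ?A"
    by (rule card_seteq[OF A(1) img]) (use A inj in \<open>simp add: card_image\<close>)
  then have "bij_betw ?f (carrier M) (carrier (Hom_group M QZ))"
    using inj by (simp add: bij_betw_def Hom_group_def)
  moreover have "?f \<in> hom M (Hom_group M QZ)"
    using restrict_form_hom
    by (intro homI) (simp_all add: Hom_group_def form_mult_left cong: restrict_cong)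
  ultimately show "nondegenerate M \<beta>"
    by (simp add: nondegenerate_def iso_def)
qed

text \<open>Non-degeneracy embeds \<open>H\<close> into the group of characters of \<open>M\<close> that vanish on \<open>perp M \<beta> H\<close>, which
  gives the inequality opposite to that of \<open>card_le_card_mult_perp\<close>.\<close>

lemma card_mult_perp:
  assumes nd: "nondegenerate M \<beta>" and H: "subgroup H M"
  shows "card H * card (perp M \<beta> H) = card (carrier M)"
proof (rule antisym)
  let ?f = "\<lambda>m. \<lambda>m'\<in>carrier M. \<beta> m m'"
  have H_in: "H \<subseteq> carrier M" using subgroup.subset[OF H] .
  have "inj_on ?f H"
    using inj_on_form_if_radical_trivial nd nondegenerate_iff_radical_trivial H_in inj_on_subset by blast
  moreover have "?f ` H \<subseteq> QZ_annihilator M (perp M \<beta> H)"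
    using restrict_form_hom H_in form_sym unfolding QZ_annihilator_def perp_def
    by (auto simp: subset_iff)
  ultimately have "card H \<le> card (QZ_annihilator M (perp M \<beta> H))"
    using card_QZ_annihilator[OF fin subgroup_perp[OF H_in]] by (meson card_inj_on_le)
  then show "card H * card (perp M \<beta> H) \<le> card (carrier M)"
    using card_QZ_annihilator[OF fin subgroup_perp[OF H_in]] mult_le_mono1 order_trans by blast
qed (rule card_le_card_mult_perp[OF H])

lemma perp_perp:
  assumes nd: "nondegenerate M \<beta>" and H: "subgroup H M"
  shows "perp M \<beta> (perp M \<beta> H) = H"
proof -
  have H_in: "H \<subseteq> carrier M" using subgroup.subset[OF H] .
  have sub: "subgroup (perp M \<beta> H) M" by (rule subgroup_perp[OF H_in])
  have "card (perp M \<beta> H) > 0"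
    using subgroup.one_closed[OF sub] finite_subset_carrier[OF perp_subset] by (auto simp: card_gt_0_iff)
  moreover have "card (perp M \<beta> H) * card (perp M \<beta> (perp M \<beta> H)) = card H * card (perp M \<beta> H)"
    using card_mult_perp[OF nd H] card_mult_perp[OF nd sub] by simp
  ultimately have "card (perp M \<beta> (perp M \<beta> H)) = card H" by simp
  moreover have "H \<subseteq> perp M \<beta> (perp M \<beta> H)"
    by (rule subset_perp_swap[OF perp_subset _ H_in]) simp
  ultimately show ?thesis
    using card_seteq[OF finite_subset_carrier[OF perp_subset]] by (metis order_refl)
qed

end

section \<open>The components of a decomposition\<close>

lemma pow_sum_integer_mod_group:
  assumes "y \<in> carrier (sum_group {..<n::nat} (\<lambda>_. integer_mod_group q))"
  shows "y [^]\<^bsub>sum_group {..<n} (\<lambda>_. integer_mod_group q)\<^esub> (k::nat) =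
    (\<lambda>i\<in>{..<n}. (int k * y i) mod int q)"
proof (induction k)
  case (Suc k)
  have "(int k * a mod int q + a) mod int q = (int (Suc k) * a) mod int q" for a
    by (simp add: mod_add_right_eq distrib_right add.commute)
  then show ?case
    by (simp only: nat_pow_Suc Suc.IH mult_sum_group mult_integer_mod_group)
       (auto simp: fun_eq_iff)
qed simp

text \<open>In \<open>\<int>/mn\<int>\<close> the elements killed by \<open>m\<close> are the multiples of \<open>n\<close>, and this passes to sums of copies.\<close>

lemma free_mod_torsion_divisible:
  assumes G: "group G" and free: "free_mod (m * n) G" and mn: "0 < m" "0 < n"
    and x: "x \<in> carrier G" "x [^]\<^bsub>G\<^esub> m = \<one>\<^bsub>G\<^esub>"
  shows "\<exists>y\<in>carrier G. x = y [^]\<^bsub>G\<^esub> n"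
proof -
  obtain r h where h: "h \<in> iso G (sum_group {..<r::nat} (\<lambda>_. integer_mod_group (m * n)))"
    using free by (auto simp: free_mod_def is_iso_def)
  let ?S = "sum_group {..<r} (\<lambda>_. integer_mod_group (m * n))"
  have hom: "h \<in> hom G ?S" and inj: "inj_on h (carrier G)" and img: "h ` carrier G = carrier ?S"
    using h by (auto simp: iso_def bij_betw_def)
  interpret h: group_hom G ?S h
    using G hom by (simp add: group_hom_def group_hom_axioms_def)
  have carr: "carrier ?S = {..<r} \<rightarrow>\<^sub>E {0..<int (m * n)}"
    using mn by (auto simp: carrier_sum_group carrier_integer_mod_group PiE_def Pi_def)
  have hx: "h x \<in> carrier ?S" using x by simp
  have "h x [^]\<^bsub>?S\<^esub> m = \<one>\<^bsub>?S\<^esub>"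
    using x h.hom_nat_pow[of x m] by simp
  then have "(\<lambda>i\<in>{..<r}. (int m * h x i) mod int (m * n)) i = (\<lambda>i\<in>{..<r}. 0) i" for i
    by (simp only: pow_sum_integer_mod_group[OF hx] one_sum_group one_integer_mod_group)
  then have "(int m * h x i) mod int (m * n) = 0" if "i < r" for i
    using that by (metis lessThan_iff restrict_apply')
  then have "int m * int n dvd int m * h x i" if "i < r" for i
    using that by (metis mod_eq_0_iff_dvd of_nat_mult)
  then have dvd: "int n dvd h x i" if "i < r" for i
    using that mn by simp
  define z where "z = (\<lambda>i\<in>{..<r}. h x i div int n)"
  have "h x i div int n < int (m * n)" "0 \<le> h x i div int n" if "i < r" for i
  proof -
    have hxi: "0 \<le> h x i" "h x i < int (m * n)"
      using PiE_mem[of "h x" "{..<r}" "\<lambda>_. {0..<int (m * n)}" i] hx that unfolding carr by auto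
    have "h x i div int n \<le> h x i"
      using mn hxi by (cases "h x i = 0") (auto intro: int_div_le_self)
    then show "h x i div int n < int (m * n)" "0 \<le> h x i div int n"
      using mn hxi by (simp_all add: pos_imp_zdiv_nonneg_iff)
  qed
  then have z: "z \<in> carrier ?S"
    unfolding carr z_def by auto
  have "z [^]\<^bsub>?S\<^esub> n = h x"
  proof
    fix i
    have "h x i mod int (m * n) = h x i" if "i < r"
      using PiE_mem[of "h x" "{..<r}" "\<lambda>_. {0..<int (m * n)}" i] hx that unfolding carr by simp
    moreover have "h x i = undefined" if "\<not> i < r"
      using PiE_arb[of "h x" "{..<r}" "\<lambda>_. {0..<int (m * n)}" i] hx that unfolding carr by simp
    moreover have "int n * z i = h x i" if "i < r"
      using dvd[OF that] that by (simp add: z_def)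
    ultimately show "(z [^]\<^bsub>?S\<^esub> n) i = h x i"
      by (simp add: pow_sum_integer_mod_group[OF z] del: of_nat_mult)
  qed
  moreover obtain y where y: "y \<in> carrier G" "z = h y"
    using z img by auto
  ultimately have "h x = h (y [^]\<^bsub>G\<^esub> n)"
    using h.hom_nat_pow[of y n] by simp
  then show ?thesis
    using inj x y h.G.nat_pow_closed by (metis inj_onD)
qed

text \<open>The decomposition in a form that allows computations: the finite set \<open>T\<close> contains all
  indices with non-trivial \<open>F p i\<close>, and \<open>\<pi> p i\<close> is the projection to \<open>F p i\<close>.  Working over the finite set
  \<open>T\<close> replaces the sum over all prime powers by an ordinary finite product.\<close>

locale primary_split = comm_group M for M (structure) +
  fixes F :: "nat \<Rightarrow> nat \<Rightarrow> 'a set" and \<pi> :: "nat \<Rightarrow> nat \<Rightarrow> 'a \<Rightarrow> 'a" and T :: "(nat \<times> nat) set"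
  assumes finite_T: "finite T"
    and T_prime: "(p, i) \<in> T \<Longrightarrow> Factorial_Ring.prime p"
    and T_pos: "(p, i) \<in> T \<Longrightarrow> 0 < i"
    and subgroup_F: "(p, i) \<in> T \<Longrightarrow> subgroup (F p i) M"
    and free_F: "(p, i) \<in> T \<Longrightarrow> free_mod (p ^ i) (M\<lparr>carrier := F p i\<rparr>)"
    and proj_hom: "(p, i) \<in> T \<Longrightarrow> \<pi> p i \<in> hom M M"
    and proj_in: "(p, i) \<in> T \<Longrightarrow> x \<in> carrier M \<Longrightarrow> \<pi> p i x \<in> F p i"
    and proj_same: "(p, i) \<in> T \<Longrightarrow> x \<in> F p i \<Longrightarrow> \<pi> p i x = x"
    and proj_other: "(p, i) \<in> T \<Longrightarrow> (q, j) \<in> T \<Longrightarrow> (p, i) \<noteq> (q, j) \<Longrightarrow> x \<in> F p i \<Longrightarrow> \<pi> q j x = \<one>"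
    and F_trivial: "Factorial_Ring.prime p \<Longrightarrow> 0 < i \<Longrightarrow> (p, i) \<notin> T \<Longrightarrow> F p i = {\<one>}"
    and finprod_proj: "x \<in> carrier M \<Longrightarrow> finprod M (\<lambda>(p, i). \<pi> p i x) T = x"

lemma (in comm_group) primary_split_exists:
  assumes fin: "finite (carrier G)" and decomp: "primary_decomposition G F"
  obtains \<pi> where "primary_split G F \<pi> {(p, i). Factorial_Ring.prime p \<and> 0 < i \<and> F p i \<noteq> {\<one>}}"
proof -
  define T where "T = {(p, i). Factorial_Ring.prime p \<and> 0 < i \<and> F p i \<noteq> {\<one>}}"
  define I :: "(nat \<times> nat) set" where "I = {(p, i). Factorial_Ring.prime p \<and> 0 < i}"
  define A where "A = (\<lambda>(p, i). G\<lparr>carrier := F p i\<rparr>)"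
  define h where "h = (\<lambda>x. gfinprod G x I)"
  let ?S = "sum_group I A"
  have sub: "subgroup (F p i) G" and free: "free_mod (p ^ i) (G\<lparr>carrier := F p i\<rparr>)"
    if "(p, i) \<in> I" for p i
    using decomp that by (auto simp: primary_decomposition_def I_def Let_def)
  have iso: "h \<in> iso ?S G"
    using decomp unfolding primary_decomposition_def Let_def I_def A_def h_def by (rule conjunct2)
  have grpA: "group (A t)" if "t \<in> I" for t
    using that sub subgroup_imp_group by (cases t) (auto simp: A_def)
  have oneA: "\<one>\<^bsub>A t\<^esub> = \<one>" and multA: "x \<otimes>\<^bsub>A t\<^esub> y = x \<otimes> y" for t x y
    by (simp_all add: A_def case_prod_unfold)
  have carA: "carrier (A (p, i)) = F p i" for p i by (simp add: A_def)
  have F_in: "x \<in> carrier G" if "(p, i) \<in> I" "x \<in> F p i" for p i x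
    by (rule subgroup.mem_carrier[OF sub[OF that(1)] that(2)])
  have grpS: "group ?S" using grpA by simp
  define g where "g = inv_into (carrier ?S) h"
  have g_iso: "g \<in> iso G ?S"
    unfolding g_def by (rule group.iso_set_sym[OF grpS iso])
  have g_in: "g x \<in> carrier ?S" if "x \<in> carrier G" for x
    using g_iso that by (auto simp: iso_def hom_def)
  have gh: "g (h s) = s" if "s \<in> carrier ?S" for s
    using iso that by (auto simp: g_def iso_def bij_betw_def)
  have hg: "h (g x) = x" if "x \<in> carrier G" for x
    using iso that by (auto simp: g_def iso_def bij_betw_def f_inv_into_f)
  have comp_in: "g x (p, i) \<in> F p i" if "(p, i) \<in> I" "x \<in> carrier G" for p i x
    using g_in[OF that(2)] that(1) by (auto simp: carrier_sum_group grpA carA dest: PiE_mem)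
  have single: "g x t = (if t = (p, i) then x else \<one>)" if "(p, i) \<in> I" "t \<in> I" "x \<in> F p i" for p i t x
  proof -
    define s where "s = (\<lambda>t\<in>I. if t = (p, i) then x else \<one>)"
    have "{t \<in> I. s t \<noteq> \<one>} \<subseteq> {(p, i)}" by (auto simp: s_def)
    then have fins: "finite {t \<in> I. s t \<noteq> \<one>}" using finite_subset by blast
    have "s t \<in> carrier (A t)" if "t \<in> I" for t
      using \<open>x \<in> F p i\<close> that subgroup.one_closed[OF sub]
      by (cases t) (auto simp: s_def carA)
    then have s: "s \<in> carrier ?S"
      using fins by (auto simp: carrier_sum_group grpA oneA s_def)
    have "h s = x"
    proof -
      have x_in: "x \<in> carrier G" by (rule F_in[OF that(1,3)])
      have s_at: "s (p, i) = x" using that by (simp add: s_def)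
      have "finprod G s {t \<in> I. s t \<noteq> \<one>} = finprod G s {(p, i)}"
      proof (cases "x = \<one>")
        case True
        then have "{t \<in> I. s t \<noteq> \<one>} = {}" by (auto simp: s_def)
        then show ?thesis using True s_at by (simp only: finprod_empty) (simp add: finprod_insert)
      next
        case False
        then have "{t \<in> I. s t \<noteq> \<one>} = {(p, i)}" using that by (auto simp: s_def)
        then show ?thesis by simp
      qed
      also have "\<dots> = x" using s_at x_in by (simp add: finprod_insert)
      finally show ?thesis using fins by (simp add: h_def gfinprod_def)
    qed
    then have "g x = s" using gh[OF s] by simp
    then show ?thesis using that by (simp add: s_def)
  qed
  have T_I: "T \<subseteq> I" unfolding T_def I_def by blast
  have "\<forall>t\<in>T. \<exists>y. y \<in> F (fst t) (snd t) \<and> y \<noteq> \<one>"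
  proof
    fix t assume t: "t \<in> T"
    obtain p i where pi: "t = (p, i)" by (cases t)
    then have "(p, i) \<in> I" "F p i \<noteq> {\<one>}" using t by (simp_all add: I_def T_def)
    moreover have "\<one> \<in> F p i"
      using calculation by (intro subgroup.one_closed[OF sub])
    ultimately have "\<exists>y. y \<in> F p i \<and> y \<noteq> \<one>" by blast
    then show "\<exists>y. y \<in> F (fst t) (snd t) \<and> y \<noteq> \<one>" by (simp add: pi)
  qed
  \<comment> \<open>A choice of non-trivial elements is injective in the index, as distinct components meet
    trivially; so \<open>T\<close> is no larger than the group.\<close>
  then obtain y where y: "\<And>t. t \<in> T \<Longrightarrow> y t \<in> F (fst t) (snd t) \<and> y t \<noteq> \<one>"
    by metis
  have "inj_on y T"
  proof (rule inj_onI)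
    fix s t assume st: "s \<in> T" "t \<in> T" "y s = y t"
    have I: "(fst s, snd s) \<in> I" "(fst t, snd t) \<in> I" "t \<in> I"
      using subsetD[OF T_I st(1)] subsetD[OF T_I st(2)] by simp_all
    have ys: "y s \<in> F (fst s) (snd s)" "y s \<in> F (fst t) (snd t)" "y s \<noteq> \<one>"
      using y[OF st(1)] y[OF st(2)] st(3) by simp_all
    have "g (y s) t = (if t = (fst s, snd s) then y s else \<one>)"
      by (rule single[OF I(1,3) ys(1)])
    moreover have "g (y s) t = y s"
      using single[OF I(2,3) ys(2)] by simp
    ultimately have "t = (fst s, snd s)" using ys(3) by metis
    then show "s = t" by simp
  qed
  moreover have "y ` T \<subseteq> carrier G"
  proof
    fix z assume "z \<in> y ` T"
    then obtain p i where "(p, i) \<in> T" "z = y (p, i)" by auto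
    then show "z \<in> carrier G" using F_in[of p i] y[of "(p, i)"] T_I by auto
  qed
  ultimately have finT: "finite T" using fin inj_on_finite by blast
  have "primary_split G F (\<lambda>p i x. g x (p, i)) T"
  proof (intro primary_split.intro primary_split_axioms.intro comm_group_axioms)
    show "finite T" by (rule finT)
  next
    fix p i x assume "(p, i) \<in> T" and x: "x \<in> F p i"
    then have pi: "(p, i) \<in> I" using T_I by blast
    show "g x (p, i) = x" using single[OF pi pi x] by simp
  next
    fix p i q j x assume "(p, i) \<in> T" "(q, j) \<in> T" "(p, i) \<noteq> (q, j)" and x: "x \<in> F p i"
    then have pi: "(p, i) \<in> I" "(q, j) \<in> I" using T_I by blast+
    show "g x (q, j) = \<one>" using single[OF pi x] \<open>(p, i) \<noteq> (q, j)\<close> by auto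
  next
    fix p i assume "(p, i) \<in> T"
    then have pi: "(p, i) \<in> I" using T_I by blast
    show "(\<lambda>x. g x (p, i)) \<in> hom G G"
    proof (rule homI)
      fix x z assume "x \<in> carrier G" "z \<in> carrier G"
      then have "g (x \<otimes> z) = g x \<otimes>\<^bsub>?S\<^esub> g z"
        using g_iso by (auto simp: iso_def hom_def)
      then show "g (x \<otimes> z) (p, i) = g x (p, i) \<otimes> g z (p, i)"
        using pi by (simp add: multA)
    qed (use comp_in[OF pi] F_in[OF pi] in auto)
  next
    fix x assume x: "x \<in> carrier G"
    have fin_supp: "finite {t \<in> I. g x t \<noteq> \<one>}"
      using g_in[OF x] by (auto simp: carrier_sum_group grpA oneA)
    have "x = finprod G (g x) {t \<in> I. g x t \<noteq> \<one>}"
      using hg[OF x] fin_supp by (simp add: h_def gfinprod_def)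
    also have "\<dots> = finprod G (\<lambda>(p, i). g x (p, i)) T"
    proof (rule finprod_mono_neutral_cong_left[OF finT])
      show "{t \<in> I. g x t \<noteq> \<one>} \<subseteq> T"
      proof
        fix t assume t: "t \<in> {t \<in> I. g x t \<noteq> \<one>}"
        obtain p i where pi: "t = (p, i)" by (cases t)
        have "g x (p, i) \<in> F p i" "g x (p, i) \<noteq> \<one>"
          using t comp_in[OF _ x] by (simp_all add: pi)
        then have "F p i \<noteq> {\<one>}" by blast
        then show "t \<in> T" using t by (simp add: pi T_def I_def)
      qed
      show "(case t of (p, i) \<Rightarrow> g x (p, i)) = \<one>" if "t \<in> T - {t \<in> I. g x t \<noteq> \<one>}" for t
        using that T_I by (cases t) auto
      show "(\<lambda>(p, i). g x (p, i)) \<in> T \<rightarrow> carrier G"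
        using F_in[OF _ comp_in[OF _ x]] T_I by (simp add: Pi_iff subset_iff Ball_def)
    qed auto
    finally show "finprod G (\<lambda>(p, i). g x (p, i)) T = x" by simp
  next
    fix p i assume "Factorial_Ring.prime p" "0 < i" "(p, i) \<notin> T"
    then show "F p i = {\<one>}" by (simp add: T_def)
  next
    fix p i assume "(p, i) \<in> T"
    then have pi: "(p, i) \<in> I" using T_I by blast
    then show "Factorial_Ring.prime p" "0 < i" by (simp_all add: I_def)
    show "subgroup (F p i) G" "free_mod (p ^ i) (G\<lparr>carrier := F p i\<rparr>)"
      by (fact sub[OF pi] free[OF pi])+
    show "g x (p, i) \<in> F p i" if "x \<in> carrier G" for x
      by (rule comp_in[OF pi that])
  qed
  then show thesis unfolding T_def by (rule that)
qed

section \<open>Subgroups given by divisibility of the components\<close>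

lemma (in comm_monoid) hom_finprod:
  assumes H: "comm_monoid H" and h: "h \<in> hom G H" "h \<one> = \<one>\<^bsub>H\<^esub>" and f: "f \<in> A \<rightarrow> carrier G"
  shows "h (finprod G f A) = finprod H (\<lambda>a. h (f a)) A"
  using f
proof (induction A rule: infinite_finite_induct)
  case (insert a A)
  interpret H: comm_monoid H by (rule H)
  have "f \<in> A \<rightarrow> carrier G" "f a \<in> carrier G" using insert.prems by auto
  moreover have "h x \<in> carrier H" if "x \<in> carrier G" for x
    using hom_carrier[OF h(1)] that by auto
  ultimately show ?case
    using insert hom_mult[OF h(1)] by (simp add: Pi_iff)
qed (simp_all add: h comm_monoid.finprod_infinite[OF H] comm_monoid.finprod_empty[OF H])

lemma (in comm_monoid) finprod_eq_single:
  assumes "finite A" "a \<in> A" "f a \<in> carrier G" "\<And>b. b \<in> A \<Longrightarrow> b \<noteq> a \<Longrightarrow> f b = \<one>"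
  shows "finprod G f A = f a"
proof -
  have "finprod G f A = finprod G f {a}"
    using assms by (intro finprod_mono_neutral_cong_right) force+
  then show ?thesis using assms by (simp add: finprod_insert)
qed

context primary_split
begin

text \<open>Additively, this is \<open>p\<^sup>k F p i\<close>.\<close>

definition pow_F :: "nat \<Rightarrow> nat \<Rightarrow> nat \<Rightarrow> 'a set"
  where "pow_F p i k = (\<lambda>x. x [^] (p ^ k)) ` F p i"

lemma F_in: "(p, i) \<in> T \<Longrightarrow> x \<in> F p i \<Longrightarrow> x \<in> carrier M"
  by (rule subgroup.mem_carrier[OF subgroup_F])

lemma F_killed: "(p, i) \<in> T \<Longrightarrow> x \<in> F p i \<Longrightarrow> x [^] (p ^ i) = \<one>"
  using free_mod_pow_eq_one[OF subgroup_imp_group[OF subgroup_F] free_F, of p i x]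
  by (simp add: nat_pow_consistent[symmetric])

lemma subgroup_pow_F:
  assumes pi: "(p, i) \<in> T"
  shows "subgroup (pow_F p i k) M"
proof (rule subgroupI)
  note F = subgroup_F[OF pi]
  note in_M = F_in[OF pi]
  show "pow_F p i k \<subseteq> carrier M" using in_M by (auto simp: pow_F_def)
  show "pow_F p i k \<noteq> {}" using subgroup.one_closed[OF F] by (auto simp: pow_F_def)
  show "inv x \<in> pow_F p i k" if "x \<in> pow_F p i k" for x
  proof -
    obtain z where "z \<in> F p i" "x = z [^] (p ^ k)" using \<open>x \<in> pow_F p i k\<close> by (auto simp: pow_F_def)
    then show ?thesis
      using subgroup.m_inv_closed[OF F] in_M
      by (auto simp: pow_F_def nat_pow_inv[symmetric] intro!: image_eqI[of _ _ "inv z"])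
  qed
  show "x \<otimes> y \<in> pow_F p i k" if xy: "x \<in> pow_F p i k" "y \<in> pow_F p i k" for x y
  proof -
    obtain z w where "z \<in> F p i" "x = z [^] (p ^ k)" "w \<in> F p i" "y = w [^] (p ^ k)"
      using xy unfolding pow_F_def by blast
    then show ?thesis
      using subgroup.m_closed[OF F] in_M
      by (auto simp: pow_F_def nat_pow_distrib[symmetric] intro!: image_eqI[of _ _ "z \<otimes> w"])
  qed
qed

lemma pow_F_0 [simp]: "(p, i) \<in> T \<Longrightarrow> pow_F p i 0 = F p i"
  using F_in by (force simp: pow_F_def)

lemma pow_F_antimono:
  assumes pi: "(p, i) \<in> T" and "k \<le> l"
  shows "pow_F p i l \<subseteq> pow_F p i k"
proof
  fix x assume "x \<in> pow_F p i l"
  then obtain z where z: "z \<in> F p i" "x = z [^] (p ^ l)" by (auto simp: pow_F_def)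
  have "x = (z [^] (p ^ (l - k))) [^] (p ^ k)"
    using z F_in[OF pi] assms by (simp add: nat_pow_pow power_add[symmetric])
  then show "x \<in> pow_F p i k"
    using subgroup_nat_pow_closed[OF subgroup_F[OF pi] z(1)] by (auto simp: pow_F_def)
qed

lemma pow_F_top:
  assumes "(p, i) \<in> T" "i \<le> k"
  shows "pow_F p i k = {\<one>}"
proof -
  have "pow_F p i i \<subseteq> {\<one>}"
    using F_killed[OF assms(1)] by (auto simp: pow_F_def)
  moreover have "\<one> \<in> pow_F p i k"
    using subgroup.one_closed[OF subgroup_pow_F] assms by blast
  ultimately show ?thesis using pow_F_antimono[OF assms] by blast
qed

lemma pow_mem_pow_F: "x \<in> pow_F p i k \<Longrightarrow> (p, i) \<in> T \<Longrightarrow> x [^] (p ^ l) \<in> pow_F p i (k + l)"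
  using F_in by (auto simp: pow_F_def nat_pow_pow power_add)

text \<open>Divisibility in the free module \<open>F p i\<close> behaves as in \<open>\<int>/p\<^sup>i\<int>\<close>: if \<open>p\<^sup>k x = p\<^sup>l z\<close> then
  \<open>x - p\<^sup>l\<^sup>-\<^sup>k z\<close> is killed by \<open>p\<^sup>k\<close>, hence a multiple of \<open>p\<^sup>i\<^sup>-\<^sup>k\<close>.  The bound \<open>l \<le> i\<close>
  makes this a multiple of \<open>p\<^sup>l\<^sup>-\<^sup>k\<close>.\<close>

lemma pow_F_divide:
  assumes pi: "(p, i) \<in> T" and x: "x \<in> F p i" "x [^] (p ^ k) \<in> pow_F p i l" and "k \<le> l" "l \<le> i"
  shows "x \<in> pow_F p i (l - k)"
proof -
  note F = subgroup_F[OF pi]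
  have p: "0 < p" using T_prime[OF pi] prime_gt_0_nat by blast
  obtain z where z: "z \<in> F p i" "x [^] (p ^ k) = z [^] (p ^ l)" using x by (auto simp: pow_F_def)
  define y where "y = z [^] (p ^ (l - k))"
  have y: "y \<in> pow_F p i (l - k)" using z by (auto simp: pow_F_def y_def)
  have y_F: "y \<in> F p i" using subgroup_nat_pow_closed[OF F z(1)] by (simp add: y_def)
  have in_M: "x \<in> carrier M" "y \<in> carrier M" "z \<in> carrier M" using F_in[OF pi] x y_F z by auto
  have "y [^] (p ^ k) = x [^] (p ^ k)"
    using in_M assms by (simp add: y_def nat_pow_pow power_add[symmetric] z)
  then have 1: "(x \<otimes> inv y) [^] (p ^ k) = \<one>"
    using in_M by (simp add: nat_pow_distrib nat_pow_inv)
  have xy: "x \<otimes> inv y \<in> F p i"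
    using x y_F subgroup.m_closed[OF F] subgroup.m_inv_closed[OF F] by blast
  have "\<exists>w\<in>carrier (M\<lparr>carrier := F p i\<rparr>). x \<otimes> inv y = w [^]\<^bsub>M\<lparr>carrier := F p i\<rparr>\<^esub> (p ^ (i - k))"
  proof (rule free_mod_torsion_divisible)
    show "group (M\<lparr>carrier := F p i\<rparr>)" by (rule subgroup_imp_group[OF F])
    show "free_mod (p ^ k * p ^ (i - k)) (M\<lparr>carrier := F p i\<rparr>)"
      using free_F[OF pi] assms by (simp add: power_add[symmetric])
  qed (use p xy 1 in \<open>simp_all add: nat_pow_consistent[symmetric]\<close>)
  then have "x \<otimes> inv y \<in> pow_F p i (i - k)"
    by (auto simp: pow_F_def nat_pow_consistent[symmetric])
  then have "x \<otimes> inv y \<in> pow_F p i (l - k)"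
    using subsetD[OF pow_F_antimono[OF pi diff_le_mono[OF \<open>l \<le> i\<close>]]] by blast
  then have "(x \<otimes> inv y) \<otimes> y \<in> pow_F p i (l - k)"
    using y subgroup.m_closed[OF subgroup_pow_F[OF pi]] by blast
  then show ?thesis using in_M by (simp add: m_assoc)
qed

lemma pow_F_coprime_pow:
  assumes pi: "(p, i) \<in> T" and x: "x \<in> F p i" "x [^] n \<in> pow_F p i k" and "coprime n p"
  shows "x \<in> pow_F p i k"
proof (rule mem_subgroup_if_coprime_pows[OF subgroup_pow_F[OF pi] F_in[OF pi x(1)] x(2)])
  show "x [^] (p ^ i) \<in> pow_F p i k"
    using F_killed[OF pi x(1)] subgroup.one_closed[OF subgroup_pow_F[OF pi]] by simp
  show "coprime n (p ^ i)" using assms by simp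
qed

lemma proj_in_M: "(p, i) \<in> T \<Longrightarrow> x \<in> carrier M \<Longrightarrow> \<pi> p i x \<in> carrier M"
  using proj_in F_in by blast

lemma proj_mult: "(p, i) \<in> T \<Longrightarrow> x \<in> carrier M \<Longrightarrow> y \<in> carrier M \<Longrightarrow> \<pi> p i (x \<otimes> y) = \<pi> p i x \<otimes> \<pi> p i y"
  using hom_mult[OF proj_hom] by simp

lemma proj_pow: "(p, i) \<in> T \<Longrightarrow> x \<in> carrier M \<Longrightarrow> \<pi> p i (x [^] (n::nat)) = \<pi> p i x [^] n"
  using hom_nat_pow[OF proj_hom _ is_group is_group] by simp

lemma proj_one: "(p, i) \<in> T \<Longrightarrow> \<pi> p i \<one> = \<one>"
  using hom_one[OF proj_hom is_group is_group] by simp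

lemma proj_inv: "(p, i) \<in> T \<Longrightarrow> x \<in> carrier M \<Longrightarrow> \<pi> p i (inv x) = inv (\<pi> p i x)"
  using group_hom.hom_inv[of M M "\<pi> p i" x] proj_hom
  by (simp add: group_hom_def group_hom_axioms_def)

lemma finprod_in_M:
  assumes f: "\<And>q j. (q, j) \<in> T \<Longrightarrow> f q j \<in> F q j"
  shows "finprod M (\<lambda>(q, j). f q j) T \<in> carrier M"
  using F_in[OF _ f] by (intro finprod_closed) auto

lemma proj_finprod:
  assumes pi: "(p, i) \<in> T" and f: "\<And>q j. (q, j) \<in> T \<Longrightarrow> f q j \<in> F q j"
  shows "\<pi> p i (finprod M (\<lambda>(q, j). f q j) T) = f p i"
proof -
  have "\<pi> p i (finprod M (\<lambda>(q, j). f q j) T) = finprod M (\<lambda>t. \<pi> p i (case t of (q, j) \<Rightarrow> f q j)) T"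
    using F_in[OF _ f] by (intro hom_finprod[OF comm_monoid_axioms proj_hom[OF pi] proj_one[OF pi]]) auto
  also have "\<dots> = \<pi> p i (case (p, i) of (q, j) \<Rightarrow> f q j)"
  proof (rule finprod_eq_single[OF finite_T pi])
    show "\<pi> p i (case (p, i) of (q, j) \<Rightarrow> f q j) \<in> carrier M"
      using f[OF pi] proj_same[OF pi] F_in[OF pi] by simp
    show "\<pi> p i (case t of (q, j) \<Rightarrow> f q j) = \<one>" if "t \<in> T" "t \<noteq> (p, i)" for t
      using that proj_other[of "fst t" "snd t" p i] pi f by (cases t) auto
  qed
  finally show ?thesis using f[OF pi] proj_same[OF pi] by simp
qed

lemma eq_one_if_proj: "x \<in> carrier M \<Longrightarrow> (\<And>p i. (p, i) \<in> T \<Longrightarrow> \<pi> p i x = \<one>) \<Longrightarrow> x = \<one>"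
  using finprod_proj[of x] finprod_one_eqI[of T "\<lambda>(p, i). \<pi> p i x"] by auto

text \<open>The sum of the \<open>p\<^sup>a\<^sup>(\<^sup>i\<^sup>) F p i\<close>.  The exponent depends on \<open>i\<close> only, the same for all primes.\<close>

definition level :: "(nat \<Rightarrow> nat) \<Rightarrow> 'a set"
  where "level a = {x \<in> carrier M. \<forall>p i. (p, i) \<in> T \<longrightarrow> \<pi> p i x \<in> pow_F p i (a i)}"

lemma levelD: "x \<in> level a \<Longrightarrow> (p, i) \<in> T \<Longrightarrow> \<pi> p i x \<in> pow_F p i (a i)"
  by (simp add: level_def)

lemma level_in_M: "x \<in> level a \<Longrightarrow> x \<in> carrier M"
  by (simp add: level_def)

lemma subgroup_level: "subgroup (level a) M"
proof (rule subgroupI)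
  show "level a \<noteq> {}"
    using subgroup.one_closed[OF subgroup_pow_F] by (auto simp: level_def proj_one intro!: exI[of _ \<one>])
  show "inv x \<in> level a" if "x \<in> level a" for x
    using that subgroup.m_inv_closed[OF subgroup_pow_F] by (simp add: level_def proj_inv)
  show "x \<otimes> y \<in> level a" if "x \<in> level a" "y \<in> level a" for x y
    using that subgroup.m_closed[OF subgroup_pow_F] by (simp add: level_def proj_mult)
qed (auto simp: level_def)

lemma level_antimono: "(\<And>i. a i \<le> b i) \<Longrightarrow> level b \<subseteq> level a"
  using pow_F_antimono by (fastforce simp: level_def)

text \<open>The endomorphism \<open>\<phi>\<close> that multiplies the component in \<open>F p i\<close> by \<open>p ^ a i\<close> has its image in
  \<open>level a\<close> and its kernel in \<open>level (\<lambda>i. i - a i)\<close>.\<close>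

lemma card_le_card_mult_level:
  assumes fin: "finite (carrier M)" and a: "\<And>i. a i \<le> i"
  shows "card (carrier M) \<le> card (level a) * card (level (\<lambda>i. i - a i))"
proof -
  define \<phi> where "\<phi> x = finprod M (\<lambda>(p, i). \<pi> p i x [^] (p ^ a i)) T" for x
  have comp: "\<pi> p i x [^] (p ^ a i) \<in> F p i" if "(p, i) \<in> T" "x \<in> carrier M" for p i x
    using that proj_in subgroup_nat_pow_closed[OF subgroup_F] by blast
  have proj_\<phi>: "\<pi> p i (\<phi> x) = \<pi> p i x [^] (p ^ a i)" if "(p, i) \<in> T" "x \<in> carrier M" for p i x
    unfolding \<phi>_def using comp that by (intro proj_finprod[where f = "\<lambda>p i. \<pi> p i x [^] (p ^ a i)"])
  have fin_level: "finite (level b)" for b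
    using fin subgroup.subset[OF subgroup_level] finite_subset by blast
  have \<phi>_in: "\<phi> x \<in> carrier M" if "x \<in> carrier M" for x
    unfolding \<phi>_def using comp that by (intro finprod_in_M[where f = "\<lambda>p i. \<pi> p i x [^] (p ^ a i)"])
  have "\<phi> x \<in> level a" if "x \<in> carrier M" for x
    using that \<phi>_in proj_in by (auto simp: level_def proj_\<phi> pow_F_def)
  then have img: "\<phi> ` carrier M \<subseteq> level a" by auto
  have "finite {x \<in> carrier M. \<phi> x = c} \<and>
      card {x \<in> carrier M. \<phi> x = c} \<le> card (level (\<lambda>i. i - a i))" for c
  proof (cases "{x \<in> carrier M. \<phi> x = c} = {}")
    case True
    show ?thesis unfolding True by simp
  next
    case False
    then obtain y where y: "y \<in> carrier M" "\<phi> y = c" by auto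
    have "x \<otimes> inv y \<in> level (\<lambda>i. i - a i)" if x: "x \<in> carrier M" "\<phi> x = c" for x
    proof -
      have "\<pi> p i (x \<otimes> inv y) \<in> pow_F p i (i - a i)" if pi: "(p, i) \<in> T" for p i
      proof (rule pow_F_divide[OF pi])
        show "\<pi> p i (x \<otimes> inv y) \<in> F p i" using proj_in[OF pi] x y by simp
        have "\<pi> p i x [^] (p ^ a i) = \<pi> p i y [^] (p ^ a i)"
          using proj_\<phi>[OF pi] x y by metis
        then have "\<pi> p i (x \<otimes> inv y) [^] (p ^ a i) = \<one>"
          using x y pi by (simp add: proj_mult proj_inv nat_pow_distrib nat_pow_inv proj_in_M)
        then show "\<pi> p i (x \<otimes> inv y) [^] (p ^ a i) \<in> pow_F p i i"
          using subgroup.one_closed[OF subgroup_pow_F[OF pi]] by simp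
      qed (use a in auto)
      then show ?thesis using x y by (simp add: level_def)
    qed
    then have "(\<lambda>x. x \<otimes> inv y) ` {x \<in> carrier M. \<phi> x = c} \<subseteq> level (\<lambda>i. i - a i)" by auto
    moreover have "inj_on (\<lambda>x. x \<otimes> inv y) {x \<in> carrier M. \<phi> x = c}"
      using y by (auto intro!: inj_onI)
    ultimately show ?thesis
      using fin_level by (meson card_inj_on_le inj_on_finite)
  qed
  then show ?thesis
    using card_le_by_fibres[OF fin_level img] by blast
qed

end

section \<open>Orthogonality of the components\<close>

locale split_form = finite_bilinear_group M \<beta> + primary_split M F \<pi> T
  for M (structure) and \<beta> and F and \<pi> and T +
  assumes decomposition: "primary_decomposition M F"
begin

lemma form_finprod_left:
  assumes "f \<in> A \<rightarrow> carrier M" "y \<in> carrier M"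
  shows "\<beta> (finprod M f A) y = finprod QZ (\<lambda>a. \<beta> (f a) y) A"
  using assms by (intro hom_finprod QZ.comm_monoid_axioms form_hom_left form_one_left) auto

lemma form_eq_finprod_proj:
  assumes "x \<in> carrier M" "y \<in> carrier M"
  shows "\<beta> x y = finprod QZ (\<lambda>(p, i). \<beta> (\<pi> p i x) y) T"
proof -
  have "\<beta> x y = \<beta> (finprod M (\<lambda>(p, i). \<pi> p i x) T) y"
    using assms by (simp add: finprod_proj)
  also have "\<dots> = finprod QZ (\<lambda>t. \<beta> (case t of (p, i) \<Rightarrow> \<pi> p i x) y) T"
    using assms proj_in_M by (intro form_finprod_left) auto
  finally show ?thesis by (simp add: case_prod_unfold)
qed

lemma form_eq_one_if_proj:
  assumes "x \<in> carrier M" "y \<in> carrier M" "\<And>p i. (p, i) \<in> T \<Longrightarrow> \<beta> (\<pi> p i x) y = \<one>\<^bsub>QZ\<^esub>"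
  shows "\<beta> x y = \<one>\<^bsub>QZ\<^esub>"
  unfolding form_eq_finprod_proj[OF assms(1,2)]
  using assms by (intro QZ.finprod_one_eqI) (simp add: split_beta)

lemma form_eq_single_proj:
  assumes "x \<in> carrier M" "y \<in> carrier M" and pi: "(p, i) \<in> T"
    and "\<And>q j. (q, j) \<in> T \<Longrightarrow> (q, j) \<noteq> (p, i) \<Longrightarrow> \<beta> (\<pi> q j x) y = \<one>\<^bsub>QZ\<^esub>"
  shows "\<beta> x y = \<beta> (\<pi> p i x) y"
proof -
  have "finprod QZ (\<lambda>(p, i). \<beta> (\<pi> p i x) y) T = (case (p, i) of (p, i) \<Rightarrow> \<beta> (\<pi> p i x) y)"
  proof (rule QZ.finprod_eq_single[OF finite_T pi])
    show "(case t of (p, i) \<Rightarrow> \<beta> (\<pi> p i x) y) = \<one>\<^bsub>QZ\<^esub>" if "t \<in> T" "t \<noteq> (p, i)" for t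
      using that assms(4)[of "fst t" "snd t"] by (simp add: split_beta)
  qed (use assms proj_in_M[OF pi] in simp)
  then show ?thesis using form_eq_finprod_proj assms by simp
qed

text \<open>For \<open>p = q\<close> the value is a multiple of \<open>p\<^sup>k\<^sup>+\<^sup>l \<beta> z w\<close> with \<open>\<beta> z w\<close> killed by both \<open>p ^ i\<close> and \<open>p ^ j\<close>;
  for distinct primes \<open>\<beta> z w\<close> is killed by two coprime numbers.\<close>

lemma form_pow_F_eq_one:
  assumes pi: "(p, i) \<in> T" "(q, j) \<in> T" and x: "x \<in> pow_F p i k" and y: "y \<in> pow_F q j l"
    and le: "p = q \<Longrightarrow> min i j \<le> k + l"
  shows "\<beta> x y = \<one>\<^bsub>QZ\<^esub>"
proof -
  obtain z w where z: "z \<in> F p i" "x = z [^] (p ^ k)" and w: "w \<in> F q j" "y = w [^] (q ^ l)"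
    using x y by (auto simp: pow_F_def)
  have in_M: "z \<in> carrier M" "w \<in> carrier M" using z w F_in pi by blast+
  have zi: "\<beta> z w [^]\<^bsub>QZ\<^esub> (p ^ i) = \<one>\<^bsub>QZ\<^esub>"
    using form_pow_left[OF in_M, of "p ^ i"] F_killed[OF pi(1) z(1)] in_M by simp
  have wj: "\<beta> z w [^]\<^bsub>QZ\<^esub> (q ^ j) = \<one>\<^bsub>QZ\<^esub>"
    using form_pow_right[OF in_M, of "q ^ j"] F_killed[OF pi(2) w(1)] in_M by simp
  have xy: "\<beta> x y = \<beta> z w [^]\<^bsub>QZ\<^esub> (p ^ k * q ^ l)"
    using in_M by (simp add: z w form_pow_left form_pow_right QZ.nat_pow_pow mult.commute)
  show ?thesis
  proof (cases "p = q")
    case True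
    have "\<beta> z w [^]\<^bsub>QZ\<^esub> (p ^ min i j) = \<one>\<^bsub>QZ\<^esub>"
      using zi wj True by (simp add: min_def)
    moreover have "p ^ k * q ^ l = p ^ min i j * p ^ (k + l - min i j)"
      using le[OF True] True by (simp add: power_add[symmetric])
    ultimately show ?thesis
      unfolding xy using in_M by (simp add: QZ.nat_pow_pow[symmetric])
  next
    case False
    then have "coprime (p ^ i) (q ^ j)"
      using T_prime[OF pi(1)] T_prime[OF pi(2)] by (simp add: primes_coprime)
    then have "\<beta> z w \<in> {\<one>\<^bsub>QZ\<^esub>}"
      using QZ.mem_subgroup_if_coprime_pows[OF QZ.triv_subgroup, of "\<beta> z w"] zi wj in_M by simp
    then show ?thesis unfolding xy by simp
  qed
qed

lemma form_level_eq_one: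
  assumes ab: "\<And>i j. min i j \<le> a i + b j" and x: "x \<in> level a" and y: "y \<in> level b"
  shows "\<beta> x y = \<one>\<^bsub>QZ\<^esub>"
proof (rule form_eq_one_if_proj)
  show xy: "x \<in> carrier M" "y \<in> carrier M" using x y level_in_M by auto
  fix p i assume pi: "(p, i) \<in> T"
  have "\<beta> y (\<pi> p i x) = \<one>\<^bsub>QZ\<^esub>"
  proof (rule form_eq_one_if_proj)
    fix q j assume qj: "(q, j) \<in> T"
    show "\<beta> (\<pi> q j y) (\<pi> p i x) = \<one>\<^bsub>QZ\<^esub>"
      using ab[of i j] by (intro form_pow_F_eq_one[OF qj pi levelD[OF y qj] levelD[OF x pi]]) (simp add: min.commute add.commute)
  qed (use xy pi proj_in_M in auto)
  then show "\<beta> (\<pi> p i x) y = \<one>\<^bsub>QZ\<^esub>"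
    using form_sym xy proj_in_M[OF pi] by simp
qed

section \<open>Anisotropy in terms of elements of the group\<close>

lemma subgroup_pow_F_of_prime:
  assumes "Factorial_Ring.prime p" "0 < i"
  shows "subgroup (F p i) M" and "subgroup (pow_F p i k) M"
proof -
  have "subgroup (F p i) M \<and> subgroup (pow_F p i k) M"
  proof (cases "(p, i) \<in> T")
    case True
    then show ?thesis using subgroup_F subgroup_pow_F by blast
  next
    case False
    then have "F p i = {\<one>}" using F_trivial assms by blast
    then show ?thesis using triv_subgroup by (simp add: pow_F_def)
  qed
  then show "subgroup (F p i) M" "subgroup (pow_F p i k) M" by auto
qed

text \<open>The indices outside \<open>T\<close> contribute nothing, so the product that defines \<open>V_form\<close> becomes one over
  the finite set \<open>T\<close>, over which the bilinear form expands.\<close>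

lemma gfinprod_eq_finprod_T:
  assumes g: "\<And>i. i \<in> J \<Longrightarrow> g i \<in> carrier QZ" and out: "\<And>i. i \<in> J \<Longrightarrow> (p, i) \<notin> T \<Longrightarrow> g i = \<one>\<^bsub>QZ\<^esub>"
  shows "gfinprod QZ g J = finprod QZ (\<lambda>(q, i). if q = p \<and> i \<in> J then g i else \<one>\<^bsub>QZ\<^esub>) T"
proof -
  define D where "D = {i \<in> J. g i \<noteq> \<one>\<^bsub>QZ\<^esub>}"
  let ?h = "\<lambda>(q, i). if q = p \<and> i \<in> J then g i else \<one>\<^bsub>QZ\<^esub>"
  have sub: "Pair p ` D \<subseteq> T" using out unfolding D_def by blast
  have finD: "finite D"
    using finite_subset[OF sub finite_T] by (rule finite_imageD) (simp add: inj_on_def)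
  have "finprod QZ g D = finprod QZ (\<lambda>i. ?h (p, i)) D"
    using g by (intro QZ.finprod_cong) (simp_all add: D_def simp_implies_def Pi_iff)
  also have "\<dots> = finprod QZ ?h (Pair p ` D)"
    using g by (intro QZ.finprod_reindex[symmetric]) (simp_all add: inj_on_def D_def Pi_iff)
  also have "\<dots> = finprod QZ ?h T"
  proof (rule QZ.finprod_mono_neutral_cong_left[OF finite_T sub])
    show "?h t = \<one>\<^bsub>QZ\<^esub>" if "t \<in> T - Pair p ` D" for t
    proof -
      obtain q i where qi: "t = (q, i)" by (cases t)
      have "g i = \<one>\<^bsub>QZ\<^esub>" if "q = p" "i \<in> J"
        using \<open>t \<in> T - Pair p ` D\<close> that unfolding qi D_def by blast
      then show ?thesis by (simp add: qi)
    qed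
  qed (use g in \<open>simp_all add: Pi_iff split_beta\<close>)
  finally show ?thesis
    using finD by (simp add: gfinprod_def D_def)
qed

text \<open>Vectors of \<open>V_space\<close> are families of cosets \<open>x i + p F p i\<close>.  This replaces them by families of
  representatives \<open>x\<close>, restricted to the indices in \<open>T\<close> so that finite support is automatic.\<close>

lemma V_anisotropic_iff:
  assumes p: "Factorial_Ring.prime p" and J: "J \<subseteq> {0<..}"
  shows "anisotropic (V_space M F p J) (inv_multiples_mod_Z p) (V_form \<beta> p J) \<longleftrightarrow>
    (\<forall>x. (\<forall>i\<in>J. (p, i) \<in> T \<longrightarrow> x i \<in> F p i) \<longrightarrow>
      finprod QZ (\<lambda>(q, i). if q = p \<and> i \<in> J then \<beta> (x i) (x i) [^]\<^bsub>QZ\<^esub> (p ^ (i - 1)) else \<one>\<^bsub>QZ\<^esub>) T = \<one>\<^bsub>QZ\<^esub> \<longrightarrow>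
      (\<forall>i\<in>J. (p, i) \<in> T \<longrightarrow> x i \<in> pow_F p i 1))"
    (is "?A \<longleftrightarrow> (\<forall>x. ?in x \<longrightarrow> ?q x = \<one>\<^bsub>QZ\<^esub> \<longrightarrow> ?zero x)")
proof -
  let ?V = "V_space M F p J"
  define P where "P i = pow_F p i 1" for i
  have V: "?V = sum_group J (\<lambda>i. M\<lparr>carrier := F p i\<rparr> Mod P i)"
    by (simp add: V_space_def pow_F_def P_def)
  have oneW: "\<one>\<^bsub>inv_multiples_mod_Z p\<^esub> = \<one>\<^bsub>QZ\<^esub>"
    by (simp add: inv_multiples_mod_Z_def)
  have pos: "0 < i" if "i \<in> J" for i using J that by auto
  note subF = subgroup_pow_F_of_prime(1)[OF p pos]
  have subP: "subgroup (P i) M" if "i \<in> J" for i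
    unfolding P_def by (rule subgroup_pow_F_of_prime(2)[OF p pos[OF that]])
  have in_M: "x \<in> carrier M" if "i \<in> J" "x \<in> F p i" for i x
    by (rule subgroup.mem_carrier[OF subF[OF that(1)] that(2)])
  have P_F: "P i \<subseteq> F p i" if "i \<in> J" for i
    using subgroup_nat_pow_closed[OF subF[OF that]] by (auto simp: pow_F_def P_def)
  have trivial: "x = \<one>" if "i \<in> J" "(p, i) \<notin> T" "x \<in> F p i" for i x
    using F_trivial[OF p pos[OF that(1)] that(2)] that(3) by simp
  have grp: "group (M\<lparr>carrier := F p i\<rparr> Mod P i)" if i: "i \<in> J" for i
  proof -
    interpret F: group "M\<lparr>carrier := F p i\<rparr>" by (rule subgroup_imp_group[OF subF[OF i]])
    interpret F: comm_group "M\<lparr>carrier := F p i\<rparr>"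
      by (rule F.group_comm_groupI) (use in_M[OF i] m_comm in auto)
    have "subgroup (P i) (M\<lparr>carrier := F p i\<rparr>)"
      by (rule subgroup_incl[OF subP[OF i] subF[OF i] P_F[OF i]])
    then show ?thesis
      using F.abelian_FactGroup comm_group_def by blast
  qed
  have coset_one: "P i #> x = P i \<longleftrightarrow> x \<in> P i" if i: "i \<in> J" "x \<in> F p i" for i x
    using coset_join1[OF _ _ subP[OF i(1)]] coset_join2[OF _ subP[OF i(1)]] in_M[OF i] by blast
  define of_reps where "of_reps x = (\<lambda>i\<in>J. P i #> x i)" for x
  have reps_in: "of_reps x \<in> carrier ?V" if x: "\<forall>i\<in>J. x i \<in> F p i" for x
  proof -
    have "(p, i) \<in> T" if "i \<in> J" "of_reps x i \<noteq> P i" for i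
    proof (rule ccontr)
      assume "(p, i) \<notin> T"
      then have "x i = \<one>" using trivial x that(1) by blast
      then have "x i \<in> P i" using subgroup.one_closed[OF subP[OF that(1)]] by simp
      then show False using that coset_one x by (simp add: of_reps_def)
    qed
    then have "Pair p ` {i \<in> J. of_reps x i \<noteq> P i} \<subseteq> T" by blast
    then have "finite (Pair p ` {i \<in> J. of_reps x i \<noteq> P i})" using finite_T finite_subset by blast
    then have "finite {i \<in> J. of_reps x i \<noteq> P i}"
      by (rule finite_imageD) (simp add: inj_on_def)
    moreover have "of_reps x i \<in> carrier (M\<lparr>carrier := F p i\<rparr> Mod P i)" if "i \<in> J" for i
      using x that by (auto simp: of_reps_def carrier_FactGroup)
    ultimately show ?thesis
      unfolding V by (simp add: carrier_sum_group grp) (simp add: of_reps_def)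
  qed
  have reps_ex: "\<exists>x. (\<forall>i\<in>J. x i \<in> F p i) \<and> v = of_reps x" if v: "v \<in> carrier ?V" for v
  proof -
    have "\<exists>x\<in>F p i. v i = P i #> x" if "i \<in> J" for i
    proof -
      have "v i \<in> carrier (M\<lparr>carrier := F p i\<rparr> Mod P i)"
        using v that unfolding V by (auto simp: carrier_sum_group grp)
      then show ?thesis by (auto simp: carrier_FactGroup)
    qed
    then obtain x where x: "\<And>i. i \<in> J \<Longrightarrow> x i \<in> F p i \<and> v i = P i #> x i" by metis
    have "v \<in> extensional J"
      using v unfolding V by (simp add: carrier_sum_group grp PiE_def)
    then have "v = of_reps x"
      using x by (intro extensionalityI[of _ J]) (simp_all add: of_reps_def)
    then show ?thesis using x by blast
  qed
  have reps_one: "of_reps x = \<one>\<^bsub>?V\<^esub> \<longleftrightarrow> ?zero x" if x: "\<forall>i\<in>J. x i \<in> F p i" for x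
  proof -
    have oneV: "\<one>\<^bsub>?V\<^esub> = (\<lambda>i\<in>J. P i)" by (simp add: V)
    have "of_reps x = \<one>\<^bsub>?V\<^esub> \<longleftrightarrow> (\<forall>i\<in>J. P i #> x i = P i)"
    proof
      assume "of_reps x = \<one>\<^bsub>?V\<^esub>"
      then have eq: "(\<lambda>i\<in>J. P i #> x i) = (\<lambda>i\<in>J. P i)" unfolding oneV of_reps_def .
      show "\<forall>i\<in>J. P i #> x i = P i"
      proof
        fix i assume "i \<in> J"
        then show "P i #> x i = P i" using fun_cong[OF eq, of i] by (simp only: restrict_apply')
      qed
    next
      assume "\<forall>i\<in>J. P i #> x i = P i"
      then show "of_reps x = \<one>\<^bsub>?V\<^esub>"
        unfolding of_reps_def oneV by (intro restrict_ext) simp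
    qed
    also have "\<dots> \<longleftrightarrow> (\<forall>i\<in>J. x i \<in> P i)"
      using coset_one x by blast
    also have "\<dots> \<longleftrightarrow> ?zero x"
    proof -
      have "x i \<in> P i" if i: "i \<in> J" "(p, i) \<notin> T" for i
      proof -
        have "x i = \<one>" using trivial[OF i] x i(1) by blast
        then show ?thesis using subgroup.one_closed[OF subP[OF i(1)]] by (simp only:)
      qed
      then show ?thesis unfolding P_def[symmetric] by blast
    qed
    finally show ?thesis .
  qed
  have reps_form: "V_form \<beta> p J (of_reps x) (of_reps x) = ?q x" if x: "\<forall>i\<in>J. x i \<in> F p i" for x
  proof -
    have "x i \<in> of_reps x i" if "i \<in> J" for i
      using that x rcos_self[OF in_M subP] by (simp add: of_reps_def)
    then have "V_form \<beta> p J (of_reps x) (of_reps x) =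
        gfinprod QZ (\<lambda>i. \<beta> (x i) (x i) [^]\<^bsub>QZ\<^esub> (p ^ (i - 1))) J"
      using reps_in[OF x]
      by (intro V_form_representatives[OF comm_group_axioms form decomposition p J]) auto
    also have "\<dots> = ?q x"
    proof (rule gfinprod_eq_finprod_T)
      fix i assume i: "i \<in> J"
      then show "\<beta> (x i) (x i) [^]\<^bsub>QZ\<^esub> (p ^ (i - 1)) \<in> carrier QZ"
        using in_M x by simp
      assume "(p, i) \<notin> T"
      then have "x i = \<one>" using trivial x i by blast
      then show "\<beta> (x i) (x i) [^]\<^bsub>QZ\<^esub> (p ^ (i - 1)) = \<one>\<^bsub>QZ\<^esub>" by simp
    qed
    finally show ?thesis .
  qed
  show ?thesis
  proof
    assume A: ?A
    show "\<forall>x. ?in x \<longrightarrow> ?q x = \<one>\<^bsub>QZ\<^esub> \<longrightarrow> ?zero x"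
    proof (intro allI impI)
      fix x assume x: "?in x" and q: "?q x = \<one>\<^bsub>QZ\<^esub>"
      define x' where "x' i = (if (p, i) \<in> T then x i else \<one>)" for i
      have x': "\<forall>i\<in>J. x' i \<in> F p i"
        using x subgroup.one_closed[OF subF] by (simp add: x'_def)
      have "?q x' = ?q x"
      proof (rule QZ.finprod_cong')
        show "(\<lambda>(q, i). if q = p \<and> i \<in> J then \<beta> (x i) (x i) [^]\<^bsub>QZ\<^esub> (p ^ (i - 1)) else \<one>\<^bsub>QZ\<^esub>) \<in> T \<rightarrow> carrier QZ"
          using x in_M by (auto simp: Pi_iff)
        show "(case t of (q, i) \<Rightarrow> if q = p \<and> i \<in> J then \<beta> (x' i) (x' i) [^]\<^bsub>QZ\<^esub> (p ^ (i - 1)) else \<one>\<^bsub>QZ\<^esub>) =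
          (case t of (q, i) \<Rightarrow> if q = p \<and> i \<in> J then \<beta> (x i) (x i) [^]\<^bsub>QZ\<^esub> (p ^ (i - 1)) else \<one>\<^bsub>QZ\<^esub>)"
          if "t \<in> T" for t
          using that by (cases t) (simp add: x'_def, blast)
      qed simp
      then have "V_form \<beta> p J (of_reps x') (of_reps x') = \<one>\<^bsub>QZ\<^esub>"
        using reps_form[OF x'] q by simp
      then have "of_reps x' = \<one>\<^bsub>?V\<^esub>"
        using A reps_in[OF x'] unfolding anisotropic_def oneW by blast
      then have "?zero x'" using reps_one[OF x'] by blast
      then show "?zero x" by (simp add: x'_def)
    qed
  next
    assume B: "\<forall>x. ?in x \<longrightarrow> ?q x = \<one>\<^bsub>QZ\<^esub> \<longrightarrow> ?zero x"
    show ?A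
      unfolding anisotropic_def oneW
    proof (intro ballI impI notI)
      fix v assume v: "v \<in> carrier ?V" "v \<noteq> \<one>\<^bsub>?V\<^esub>" "V_form \<beta> p J v v = \<one>\<^bsub>QZ\<^esub>"
      obtain x where x: "\<forall>i\<in>J. x i \<in> F p i" "v = of_reps x" using reps_ex[OF v(1)] by blast
      then have "?zero x" using B v(3) reps_form[OF x(1)] by simp
      then show False using v(2) x reps_one by simp
    qed
  qed
qed

text \<open>The elements that represent vectors of \<open>V_space M F p J\<close>: the family \<open>x\<close> of representatives is
  turned into the element with components \<open>p\<^sup>k x i\<close>, where \<open>k = (i - 1) div 2\<close>.\<close>

definition supported :: "nat \<Rightarrow> nat set \<Rightarrow> 'a set"
  where "supported p J = {y \<in> carrier M.
    (\<forall>q i. (q, i) \<in> T \<longrightarrow> \<not> (q = p \<and> i \<in> J) \<longrightarrow> \<pi> q i y = \<one>) \<and>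
    (\<forall>i\<in>J. (p, i) \<in> T \<longrightarrow> \<pi> p i y \<in> pow_F p i ((i - 1) div 2))}"

text \<open>The first assumption says that \<open>p\<^sup>e \<beta>\<close> takes on \<open>p\<^sup>k x i\<close>, \<open>k = (i - 1) div 2\<close>, the value
  \<open>p\<^sup>i\<^sup>-\<^sup>1 \<beta> (x i) (x i)\<close> that occurs in \<open>V_form\<close>; the second makes the terms with \<open>i \<noteq> j\<close> vanish.  The
  odd indices satisfy both for \<open>e = 0\<close>, the even ones for \<open>e = 1\<close>.\<close>

lemma form_supported:
  assumes J: "\<And>i. i \<in> J \<Longrightarrow> 2 * ((i - 1) div 2) + e = i - 1"
    and gap: "\<And>i j. i \<in> J \<Longrightarrow> j \<in> J \<Longrightarrow> i \<noteq> j \<Longrightarrow> min i j \<le> (i - 1) div 2 + (j - 1) div 2 + e"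
    and y: "y \<in> supported p J"
    and x: "\<And>i. i \<in> J \<Longrightarrow> (p, i) \<in> T \<Longrightarrow> x i \<in> F p i \<and> \<pi> p i y = x i [^] (p ^ ((i - 1) div 2))"
  shows "\<beta> y y [^]\<^bsub>QZ\<^esub> (p ^ e) =
    finprod QZ (\<lambda>(q, i). if q = p \<and> i \<in> J then \<beta> (x i) (x i) [^]\<^bsub>QZ\<^esub> (p ^ (i - 1)) else \<one>\<^bsub>QZ\<^esub>) T"
proof -
  have y_in: "y \<in> carrier M" using y by (simp add: supported_def)
  have out: "\<pi> q i y = \<one>" if "(q, i) \<in> T" "\<not> (q = p \<and> i \<in> J)" for q i
    using y that unfolding supported_def by blast
  have ins: "\<pi> p i y \<in> pow_F p i ((i - 1) div 2)" if "(p, i) \<in> T" "i \<in> J" for i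
    using y that unfolding supported_def by blast
  have "\<beta> y y [^]\<^bsub>QZ\<^esub> (p ^ e) = \<beta> y (y [^] (p ^ e))"
    using y_in by (simp add: form_pow_right)
  also have "\<dots> = finprod QZ (\<lambda>(q, i). \<beta> (\<pi> q i y) (y [^] (p ^ e))) T"
    using y_in by (intro form_eq_finprod_proj) auto
  also have "\<dots> = finprod QZ (\<lambda>(q, i). if q = p \<and> i \<in> J then \<beta> (x i) (x i) [^]\<^bsub>QZ\<^esub> (p ^ (i - 1)) else \<one>\<^bsub>QZ\<^esub>) T"
  proof (rule QZ.finprod_cong')
    show "(\<lambda>(q, i). if q = p \<and> i \<in> J then \<beta> (x i) (x i) [^]\<^bsub>QZ\<^esub> (p ^ (i - 1)) else \<one>\<^bsub>QZ\<^esub>) \<in> T \<rightarrow> carrier QZ"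
      using x F_in by (auto simp: Pi_iff)
    fix t assume t: "t \<in> T"
    obtain q i where qi: "t = (q, i)" by (cases t)
    show "(case t of (q, i) \<Rightarrow> \<beta> (\<pi> q i y) (y [^] (p ^ e))) =
      (case t of (q, i) \<Rightarrow> if q = p \<and> i \<in> J then \<beta> (x i) (x i) [^]\<^bsub>QZ\<^esub> (p ^ (i - 1)) else \<one>\<^bsub>QZ\<^esub>)"
    proof (cases "q = p \<and> i \<in> J")
      case False
      then have "\<pi> q i y = \<one>" using out t by (simp add: qi)
      then show ?thesis using False y_in by (simp only: qi split_conv if_False form_one_left nat_pow_closed)
    next
      case True
      then have i: "i \<in> J" "(p, i) \<in> T" using t qi by auto
      let ?z = "\<pi> p i y"
      have z_in: "?z \<in> carrier M" using proj_in_M i y_in by blast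
      have x_in: "x i \<in> carrier M" using x i F_in by blast
      have ze: "?z [^] (p ^ e) \<in> pow_F p i ((i - 1) div 2 + e)"
        by (rule pow_mem_pow_F[OF ins[OF i(2,1)] i(2)])
      \<comment> \<open>The factor \<open>p\<^sup>e\<close> is moved to the other argument, where it helps to annihilate the
        cross terms.\<close>
      have "\<beta> ?z (y [^] (p ^ e)) = \<beta> y (?z [^] (p ^ e))"
        using z_in y_in by (simp add: form_pow_right form_sym)
      also have "\<dots> = \<beta> ?z (?z [^] (p ^ e))"
      proof (rule form_eq_single_proj[OF y_in _ i(2)])
        show "?z [^] (p ^ e) \<in> carrier M" using z_in by simp
        fix q j assume qj: "(q, j) \<in> T" "(q, j) \<noteq> (p, i)"
        show "\<beta> (\<pi> q j y) (?z [^] (p ^ e)) = \<one>\<^bsub>QZ\<^esub>"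
        proof (cases "q = p \<and> j \<in> J")
          case False
          then show ?thesis using out[OF qj(1)] z_in by simp
        next
          case True
          then have j: "(p, j) \<in> T" "j \<in> J" "j \<noteq> i" using qj by auto
          have "\<beta> (\<pi> p j y) (?z [^] (p ^ e)) = \<one>\<^bsub>QZ\<^esub>"
            using gap[OF j(2) i(1) j(3)] by (intro form_pow_F_eq_one[OF j(1) i(2) ins[OF j(1,2)] ze]) simp
          then show ?thesis using True by simp
        qed
      qed
      also have "\<dots> = \<beta> (x i) (x i) [^]\<^bsub>QZ\<^esub> (p ^ ((i - 1) div 2) * (p ^ ((i - 1) div 2) * p ^ e))"
      proof -
        have "?z = x i [^] (p ^ ((i - 1) div 2))" using x i by blast
        then show ?thesis
          using x_in by (simp add: nat_pow_pow form_pow_left form_pow_right QZ.nat_pow_pow mult_ac)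
      qed
      also have "p ^ ((i - 1) div 2) * (p ^ ((i - 1) div 2) * p ^ e) = p ^ (i - 1)"
        by (subst (3) J[OF i(1), symmetric]) (simp add: power_add mult_2 mult_ac)
      finally show ?thesis using True by (simp add: qi)
    qed
  qed simp
  finally show ?thesis .
qed

lemma anisotropic_iff_supported:
  assumes p: "Factorial_Ring.prime p" and pos: "J \<subseteq> {0<..}"
    and J: "\<And>i. i \<in> J \<Longrightarrow> 2 * ((i - 1) div 2) + e = i - 1"
    and gap: "\<And>i j. i \<in> J \<Longrightarrow> j \<in> J \<Longrightarrow> i \<noteq> j \<Longrightarrow> min i j \<le> (i - 1) div 2 + (j - 1) div 2 + e"
  shows "anisotropic (V_space M F p J) (inv_multiples_mod_Z p) (V_form \<beta> p J) \<longleftrightarrow>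
    (\<forall>y\<in>supported p J. \<beta> y y [^]\<^bsub>QZ\<^esub> (p ^ e) = \<one>\<^bsub>QZ\<^esub> \<longrightarrow>
      (\<forall>i\<in>J. (p, i) \<in> T \<longrightarrow> \<pi> p i y \<in> pow_F p i ((i - 1) div 2 + 1)))"
    (is "_ \<longleftrightarrow> ?R")
  unfolding V_anisotropic_iff[OF p pos]
proof (intro iffI ballI allI impI)
  let ?c = "\<lambda>i. (i - 1) div 2"
  let ?q = "\<lambda>x. finprod QZ (\<lambda>(q, i). if q = p \<and> i \<in> J then \<beta> (x i) (x i) [^]\<^bsub>QZ\<^esub> (p ^ (i - 1)) else \<one>\<^bsub>QZ\<^esub>) T"
  fix y i
  assume V: "\<forall>x. (\<forall>i\<in>J. (p, i) \<in> T \<longrightarrow> x i \<in> F p i) \<longrightarrow> ?q x = \<one>\<^bsub>QZ\<^esub> \<longrightarrow>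
      (\<forall>i\<in>J. (p, i) \<in> T \<longrightarrow> x i \<in> pow_F p i 1)"
    and y: "y \<in> supported p J" "\<beta> y y [^]\<^bsub>QZ\<^esub> (p ^ e) = \<one>\<^bsub>QZ\<^esub>" and i: "i \<in> J" "(p, i) \<in> T"
  have "\<exists>x\<in>F p i. \<pi> p i y = x [^] (p ^ ?c i)" if "i \<in> J" "(p, i) \<in> T" for i
  proof -
    have "\<pi> p i y \<in> pow_F p i (?c i)" using y(1) that unfolding supported_def by blast
    then show ?thesis by (auto simp: pow_F_def)
  qed
  then obtain x where x: "\<And>i. i \<in> J \<Longrightarrow> (p, i) \<in> T \<Longrightarrow> x i \<in> F p i \<and> \<pi> p i y = x i [^] (p ^ ?c i)"
    by metis
  have "?q x = \<one>\<^bsub>QZ\<^esub>"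
    using form_supported[OF J gap y(1) x] y(2) by simp
  then have "x i \<in> pow_F p i 1" using V x i by blast
  then show "\<pi> p i y \<in> pow_F p i (?c i + 1)"
    using pow_mem_pow_F[of "x i" p i 1 "?c i"] x[OF i] i by (simp add: add.commute)
next
  let ?c = "\<lambda>i. (i - 1) div 2"
  let ?q = "\<lambda>x. finprod QZ (\<lambda>(q, i). if q = p \<and> i \<in> J then \<beta> (x i) (x i) [^]\<^bsub>QZ\<^esub> (p ^ (i - 1)) else \<one>\<^bsub>QZ\<^esub>) T"
  fix x i
  assume R: ?R and x: "\<forall>i\<in>J. (p, i) \<in> T \<longrightarrow> x i \<in> F p i" "?q x = \<one>\<^bsub>QZ\<^esub>"
    and i: "i \<in> J" "(p, i) \<in> T"
  define f where "f q i = (if q = p \<and> i \<in> J then x i [^] (p ^ ?c i) else \<one>)" for q i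
  have f: "f q j \<in> F q j" if "(q, j) \<in> T" for q j
    using that x(1) subgroup_nat_pow_closed[OF subgroup_F] subgroup.one_closed[OF subgroup_F]
    by (auto simp: f_def)
  define y where "y = finprod M (\<lambda>(q, j). f q j) T"
  have y_in: "y \<in> carrier M" unfolding y_def by (rule finprod_in_M[OF f])
  have proj_y: "\<pi> q j y = f q j" if "(q, j) \<in> T" for q j
    unfolding y_def by (rule proj_finprod[OF that f])
  have y: "y \<in> supported p J"
    using y_in proj_y x(1) by (auto simp: supported_def f_def pow_F_def)
  have "\<beta> y y [^]\<^bsub>QZ\<^esub> (p ^ e) = ?q x"
    using x(1) by (intro form_supported[OF J gap y]) (auto simp: proj_y f_def)
  then have "x i [^] (p ^ ?c i) \<in> pow_F p i (?c i + 1)"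
    using R y x(2) i proj_y[OF i(2)] unfolding f_def by fastforce
  moreover have "?c i + 1 \<le> i" using T_pos[OF i(2)] by presburger
  ultimately show "x i \<in> pow_F p i 1"
    using pow_F_divide[OF i(2), of "x i" "?c i" "?c i + 1"] x(1) i by simp
qed

text \<open>The two exponents add up to \<open>i\<close> and increase with \<open>i\<close>, so the levels are orthogonal to each
  other; no other pair adding up to \<open>i\<close> lies closer together.\<close>

abbreviation lower :: "'a set" where "lower \<equiv> level (\<lambda>i. (i + 1) div 2)"
abbreviation upper :: "'a set" where "upper \<equiv> level (\<lambda>i. i div 2)"

lemma lower_subset_upper: "lower \<subseteq> upper"
  by (rule level_antimono) simp

lemma form_lower_upper: "x \<in> lower \<Longrightarrow> y \<in> upper \<Longrightarrow> \<beta> x y = \<one>\<^bsub>QZ\<^esub>"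
  by (rule form_level_eq_one[of "\<lambda>i. (i + 1) div 2" "\<lambda>i. i div 2"]) presburger

text \<open>The projection of \<open>y\<close> to the sum of the \<open>F p i\<close> with \<open>i \<in> J\<close>.\<close>

definition part :: "nat \<Rightarrow> nat set \<Rightarrow> 'a \<Rightarrow> 'a"
  where "part p J y = finprod M (\<lambda>(q, i). if q = p \<and> i \<in> J then \<pi> q i y else \<one>) T"

lemma part:
  assumes "y \<in> carrier M"
  shows part_in_M: "part p J y \<in> carrier M"
    and proj_part: "(q, i) \<in> T \<Longrightarrow> \<pi> q i (part p J y) = (if q = p \<and> i \<in> J then \<pi> q i y else \<one>)"
proof -
  have f: "(if q = p \<and> i \<in> J then \<pi> q i y else \<one>) \<in> F q i" if "(q, i) \<in> T" for q i
    using proj_in[OF that assms] subgroup.one_closed[OF subgroup_F[OF that]] by auto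
  show "part p J y \<in> carrier M"
    unfolding part_def by (rule finprod_in_M[OF f])
  show "\<pi> q i (part p J y) = (if q = p \<and> i \<in> J then \<pi> q i y else \<one>)" if "(q, i) \<in> T"
    unfolding part_def by (rule proj_finprod[OF that f])
qed

lemma supported_mem_level:
  assumes y: "y \<in> supported p J" and a: "\<And>i. i \<in> J \<Longrightarrow> a i \<le> (i - 1) div 2"
  shows "y \<in> level a"
  unfolding level_def
proof (intro CollectI conjI allI impI)
  show "y \<in> carrier M" using y by (simp add: supported_def)
  fix q i assume qi: "(q, i) \<in> T"
  show "\<pi> q i y \<in> pow_F q i (a i)"
  proof (cases "q = p \<and> i \<in> J")
    case True
    then have "\<pi> q i y \<in> pow_F q i ((i - 1) div 2)" using y qi unfolding supported_def by blast
    then show ?thesis using pow_F_antimono[OF qi a] True by blast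
  next
    case False
    then have "\<pi> q i y = \<one>" using y qi unfolding supported_def by blast
    then show ?thesis using subgroup.one_closed[OF subgroup_pow_F[OF qi]] by simp
  qed
qed

lemma supported_pow_mem_level:
  assumes y: "y \<in> supported p J" and a: "\<And>i. i \<in> J \<Longrightarrow> a i \<le> (i - 1) div 2 + 1"
  shows "y [^] p \<in> level a"
  unfolding level_def
proof (intro CollectI conjI allI impI)
  have y_in: "y \<in> carrier M" using y by (simp add: supported_def)
  then show "y [^] p \<in> carrier M" by simp
  fix q i assume qi: "(q, i) \<in> T"
  show "\<pi> q i (y [^] p) \<in> pow_F q i (a i)"
  proof (cases "q = p \<and> i \<in> J")
    case True
    then have "\<pi> q i y \<in> pow_F q i ((i - 1) div 2)" using y qi unfolding supported_def by blast
    then have "\<pi> q i y [^] (q ^ 1) \<in> pow_F q i ((i - 1) div 2 + 1)" using pow_mem_pow_F qi by blast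
    then show ?thesis using pow_F_antimono[OF qi a] True y_in qi by (auto simp: proj_pow)
  next
    case False
    then have "\<pi> q i y = \<one>" using y qi unfolding supported_def by blast
    then show ?thesis using subgroup.one_closed[OF subgroup_pow_F[OF qi]] y_in qi by (simp add: proj_pow)
  qed
qed

text \<open>The prime \<open>p\<close> acts invertibly on the components of the other primes.\<close>

lemma level_if_pow_mem_level:
  assumes p: "Factorial_Ring.prime p" and y: "y \<in> carrier M" "y [^] p \<in> level a" and qi: "(q, i) \<in> T" "q \<noteq> p"
  shows "\<pi> q i y \<in> pow_F q i (a i)"
proof (rule pow_F_coprime_pow[OF qi(1) proj_in[OF qi(1) y(1)]])
  show "\<pi> q i y [^] p \<in> pow_F q i (a i)"
    using levelD[OF y(2) qi(1)] y(1) qi(1) by (simp add: proj_pow)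
  show "coprime p q" using p T_prime[OF qi(1)] qi(2) by (simp add: primes_coprime)
qed

text \<open>Supported elements lie in \<open>upper\<close> and their \<open>p\<close>-folds in \<open>lower\<close>, so the right-hand side implies
  anisotropy.  Conversely let \<open>y \<in> upper\<close> with \<open>p y \<in> lower\<close>, and let \<open>u\<close> be the sum of its components
  in the \<open>F p i\<close> with \<open>i\<close> odd.  For even \<open>i\<close> the two roundings of \<open>i / 2\<close> agree, and \<open>p\<close> is invertible on
  the other primes, so \<open>y - u\<close> lies in \<open>lower\<close>; as \<open>lower\<close> is orthogonal to \<open>upper\<close>, replacing \<open>y\<close> by \<open>u\<close>
  does not change \<open>\<beta> y y\<close>.\<close>

lemma anisotropic_odd_iff:
  assumes p: "Factorial_Ring.prime p"
  shows "anisotropic (V_space M F p odd_indices) (inv_multiples_mod_Z p) (V_form \<beta> p odd_indices) \<longleftrightarrow>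
    (\<forall>y\<in>upper. y [^] p \<in> lower \<longrightarrow> \<beta> y y = \<one>\<^bsub>QZ\<^esub> \<longrightarrow> y \<in> lower)"
    (is "?A \<longleftrightarrow> ?R")
proof -
  let ?J = odd_indices
  have J: "?J \<subseteq> {0<..}" "\<And>i. i \<in> ?J \<Longrightarrow> 2 * ((i - 1) div 2) + 0 = i - 1"
    "\<And>i j. i \<in> ?J \<Longrightarrow> j \<in> ?J \<Longrightarrow> i \<noteq> j \<Longrightarrow> min i j \<le> (i - 1) div 2 + (j - 1) div 2 + 0"
    by (auto simp: odd_indices_def elim!: oddE)
  have half: "(i - 1) div 2 = i div 2" "(i - 1) div 2 + 1 = (i + 1) div 2" if "i \<in> ?J" for i
    using that by (auto simp: odd_indices_def elim!: oddE)
  have "?A \<longleftrightarrow> (\<forall>y\<in>supported p ?J. \<beta> y y = \<one>\<^bsub>QZ\<^esub> \<longrightarrow>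
      (\<forall>i\<in>?J. (p, i) \<in> T \<longrightarrow> \<pi> p i y \<in> pow_F p i ((i + 1) div 2)))"
    using anisotropic_iff_supported[OF p J] half(2) supported_def by simp
  also have "\<dots> \<longleftrightarrow> ?R"
  proof (intro iffI ballI impI)
    fix y i assume R: ?R and y: "y \<in> supported p ?J" "\<beta> y y = \<one>\<^bsub>QZ\<^esub>" and i: "i \<in> ?J" "(p, i) \<in> T"
    have "y \<in> upper" "y [^] p \<in> lower"
      using half by (intro supported_mem_level[OF y(1)] supported_pow_mem_level[OF y(1)]; simp)+
    then have "y \<in> lower" using R y(2) by blast
    then show "\<pi> p i y \<in> pow_F p i ((i + 1) div 2)" using i levelD by blast
  next
    fix y
    assume S: "\<forall>y\<in>supported p ?J. \<beta> y y = \<one>\<^bsub>QZ\<^esub> \<longrightarrow>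
        (\<forall>i\<in>?J. (p, i) \<in> T \<longrightarrow> \<pi> p i y \<in> pow_F p i ((i + 1) div 2))"
      and y: "y \<in> upper" "y [^] p \<in> lower" "\<beta> y y = \<one>\<^bsub>QZ\<^esub>"
    have y_in: "y \<in> carrier M" using y(1) level_in_M by blast
    define u where "u = part p ?J y"
    have u_in: "u \<in> carrier M" unfolding u_def by (rule part_in_M[OF y_in])
    have proj_u: "\<pi> q i u = (if q = p \<and> i \<in> ?J then \<pi> q i y else \<one>)" if "(q, i) \<in> T" for q i
      unfolding u_def by (rule proj_part[OF y_in that])
    have u: "u \<in> supported p ?J"
      using u_in levelD[OF y(1)] half by (simp add: supported_def proj_u)
    have u_upper: "u \<in> upper" using half by (intro supported_mem_level[OF u]) simp
    have rest: "\<pi> q i y \<in> pow_F q i ((i + 1) div 2)" if "(q, i) \<in> T" "\<not> (q = p \<and> i \<in> ?J)" for q i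
    proof (cases "q = p")
      case True
      then have "(i + 1) div 2 = i div 2" using that T_pos[OF that(1)] by (auto simp: odd_indices_def)
      then show ?thesis using levelD[OF y(1) that(1)] by simp
    next
      case False
      then show ?thesis using level_if_pow_mem_level[OF p y_in y(2) that(1)] by simp
    qed
    define z where "z = y \<otimes> inv u"
    have z_in: "z \<in> carrier M" using y_in u_in by (simp add: z_def)
    have "\<pi> q i z \<in> pow_F q i ((i + 1) div 2)" if "(q, i) \<in> T" for q i
      using that rest[OF that] y_in u_in proj_in_M[OF that y_in] subgroup.one_closed[OF subgroup_pow_F[OF that]]
      by (auto simp: z_def proj_mult proj_inv proj_u)
    then have z: "z \<in> lower" using z_in by (simp add: level_def)
    have y_eq: "y = u \<otimes> z" using y_in u_in by (simp add: z_def m_lcomm[of u y])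
    have uz: "\<beta> z u = \<one>\<^bsub>QZ\<^esub>" by (rule form_lower_upper[OF z u_upper])
    have "\<beta> y y = \<beta> u u"
      using u_in z_in uz form_sym[OF z_in u_in] form_lower_upper[OF z subsetD[OF lower_subset_upper z]]
      by (simp add: y_eq form_mult_left form_mult_right)
    then have "\<pi> p i y \<in> pow_F p i ((i + 1) div 2)" if "(p, i) \<in> T" "i \<in> ?J" for i
      using S u y(3) proj_u[OF that(1)] that by fastforce
    then have "\<pi> q i y \<in> pow_F q i ((i + 1) div 2)" if "(q, i) \<in> T" for q i
      using rest[OF that] that by blast
    then show "y \<in> lower" using y_in by (simp add: level_def)
  qed
  finally show ?thesis .
qed

text \<open>As for odd indices, with every layer moved by half a step: dividing \<open>p y \<in> lower\<close> by \<open>p\<close> puts the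
  components of odd index into \<open>upper\<close>, so \<open>y\<close> and its part \<open>u\<close> of even index differ by some
  \<open>z \<in> upper\<close>.  Both \<open>p u\<close> and \<open>p z\<close> lie in \<open>lower\<close>, hence are orthogonal to \<open>z\<close>, and \<open>p \<beta> y y = p \<beta> u u\<close>.\<close>

lemma anisotropic_even_iff:
  assumes p: "Factorial_Ring.prime p"
  shows "anisotropic (V_space M F p even_indices) (inv_multiples_mod_Z p) (V_form \<beta> p even_indices) \<longleftrightarrow>
    (\<forall>y\<in>carrier M. y [^] p \<in> lower \<longrightarrow> \<beta> y y [^]\<^bsub>QZ\<^esub> p = \<one>\<^bsub>QZ\<^esub> \<longrightarrow> y \<in> upper)"
    (is "?A \<longleftrightarrow> ?R")
proof -
  let ?J = even_indices
  have pos: "?J \<subseteq> {0<..}" by (auto simp: even_indices_def)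
  have J: "2 * ((i - 1) div 2) + 1 = i - 1" if "i \<in> ?J" for i
    using that unfolding even_indices_def mem_Collect_eq by presburger
  have half: "(i - 1) div 2 + 1 = i div 2" "(i - 1) div 2 + 1 = (i + 1) div 2" if "i \<in> ?J" for i
    using that unfolding even_indices_def mem_Collect_eq by presburger+
  have gap: "min i j \<le> (i - 1) div 2 + (j - 1) div 2 + 1" if ij: "i \<in> ?J" "j \<in> ?J" "i \<noteq> j" for i j
  proof -
    obtain a b where ab: "i = 2 * a" "j = 2 * b"
      using ij unfolding even_indices_def by (auto elim!: evenE)
    have "(i - 1) div 2 + 1 = a" "(j - 1) div 2 + 1 = b"
      using half(1)[OF ij(1)] half(1)[OF ij(2)] ab by simp_all
    moreover have "a < b \<or> b < a" using ij(3) ab by auto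
    ultimately show ?thesis using ab by auto
  qed
  have "?A \<longleftrightarrow> (\<forall>y\<in>supported p ?J. \<beta> y y [^]\<^bsub>QZ\<^esub> p = \<one>\<^bsub>QZ\<^esub> \<longrightarrow>
      (\<forall>i\<in>?J. (p, i) \<in> T \<longrightarrow> \<pi> p i y \<in> pow_F p i (i div 2)))"
    using anisotropic_iff_supported[OF p pos J gap] half(1) by simp
  also have "\<dots> \<longleftrightarrow> ?R"
  proof (intro iffI ballI impI)
    fix y i assume R: ?R and y: "y \<in> supported p ?J" "\<beta> y y [^]\<^bsub>QZ\<^esub> p = \<one>\<^bsub>QZ\<^esub>" and i: "i \<in> ?J" "(p, i) \<in> T"
    have "y \<in> carrier M" using y(1) by (simp add: supported_def)
    moreover have "y [^] p \<in> lower"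
      using half by (intro supported_pow_mem_level[OF y(1)]) simp
    ultimately have "y \<in> upper" using R y(2) by blast
    then show "\<pi> p i y \<in> pow_F p i (i div 2)" using i levelD by blast
  next
    fix y
    assume S: "\<forall>y\<in>supported p ?J. \<beta> y y [^]\<^bsub>QZ\<^esub> p = \<one>\<^bsub>QZ\<^esub> \<longrightarrow>
        (\<forall>i\<in>?J. (p, i) \<in> T \<longrightarrow> \<pi> p i y \<in> pow_F p i (i div 2))"
      and y_in: "y \<in> carrier M" and y: "y [^] p \<in> lower" "\<beta> y y [^]\<^bsub>QZ\<^esub> p = \<one>\<^bsub>QZ\<^esub>"
    define u where "u = part p ?J y"
    have u_in: "u \<in> carrier M" unfolding u_def by (rule part_in_M[OF y_in])
    have proj_u: "\<pi> q i u = (if q = p \<and> i \<in> ?J then \<pi> q i y else \<one>)" if "(q, i) \<in> T" for q i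
      unfolding u_def by (rule proj_part[OF y_in that])
    \<comment> \<open>Dividing \<open>p y \<in> p\<^sup>k F\<close> by \<open>p\<close> in the free module \<open>F\<close> loses exactly one power of \<open>p\<close>.\<close>
    have div_p: "\<pi> p i y \<in> pow_F p i ((i + 1) div 2 - 1)" if "(p, i) \<in> T" for i
    proof (rule pow_F_divide[OF that proj_in[OF that y_in]])
      show "\<pi> p i y [^] (p ^ 1) \<in> pow_F p i ((i + 1) div 2)"
        using levelD[OF y(1) that] y_in that by (simp add: proj_pow)
      show "1 \<le> (i + 1) div 2" "(i + 1) div 2 \<le> i" using T_pos[OF that] by presburger+
    qed
    have "\<pi> p i y \<in> pow_F p i ((i - 1) div 2)" if "(p, i) \<in> T" "i \<in> ?J" for i
      using div_p[OF that(1)] by (simp only: half(2)[OF that(2), symmetric] add_diff_cancel_right')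
    then have u: "u \<in> supported p ?J"
      using u_in by (simp add: supported_def proj_u)
    have rest: "\<pi> q i y \<in> pow_F q i (i div 2)" if "(q, i) \<in> T" "\<not> (q = p \<and> i \<in> ?J)" for q i
    proof (cases "q = p")
      case True
      then have "odd i" using that T_pos[OF that(1)] by (simp add: even_indices_def)
      then have "(i + 1) div 2 - 1 = i div 2" by presburger
      then show ?thesis using div_p[of i] True that(1) by simp
    next
      case False
      then have "\<pi> q i y \<in> pow_F q i ((i + 1) div 2)"
        using level_if_pow_mem_level[OF p y_in y(1) that(1)] by simp
      then show ?thesis using pow_F_antimono[OF that(1), of "i div 2" "(i + 1) div 2"] by auto
    qed
    define z where "z = y \<otimes> inv u"
    have z_in: "z \<in> carrier M" using y_in u_in by (simp add: z_def)
    have "\<pi> q i z \<in> pow_F q i (i div 2)" if "(q, i) \<in> T" for q i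
      using that rest[OF that] y_in u_in proj_in_M[OF that y_in] subgroup.one_closed[OF subgroup_pow_F[OF that]]
      by (auto simp: z_def proj_mult proj_inv proj_u)
    then have z: "z \<in> upper" using z_in by (simp add: level_def)
    have up: "u [^] p \<in> lower" using half by (intro supported_pow_mem_level[OF u]) simp
    have "z [^] p = y [^] p \<otimes> inv (u [^] p)"
      using y_in u_in by (simp add: z_def nat_pow_distrib nat_pow_inv)
    then have zp: "z [^] p \<in> lower"
      using y(1) up subgroup.m_closed[OF subgroup_level] subgroup.m_inv_closed[OF subgroup_level] by simp
    have y_eq: "y = u \<otimes> z" using y_in u_in by (simp add: z_def m_lcomm[of u y])
    have uz: "\<beta> u z [^]\<^bsub>QZ\<^esub> p = \<one>\<^bsub>QZ\<^esub>"
      using form_lower_upper[OF up z] u_in z_in by (simp add: form_pow_left)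
    have zz: "\<beta> z z [^]\<^bsub>QZ\<^esub> p = \<one>\<^bsub>QZ\<^esub>"
      using form_lower_upper[OF zp z] z_in by (simp add: form_pow_left)
    have "\<beta> y y [^]\<^bsub>QZ\<^esub> p = \<beta> u u [^]\<^bsub>QZ\<^esub> p"
      using u_in z_in uz zz form_sym[OF z_in u_in]
      by (simp add: y_eq form_mult_left form_mult_right QZ.nat_pow_distrib)
    then have "\<pi> p i y \<in> pow_F p i (i div 2)" if "(p, i) \<in> T" "i \<in> ?J" for i
      using S u y(2) proj_u[OF that(1)] that by fastforce
    then have "\<pi> q i y \<in> pow_F q i (i div 2)" if "(q, i) \<in> T" for q i
      using rest[OF that] that by blast
    then show "y \<in> upper" using y_in by (simp add: level_def)
  qed
  finally show ?thesis .
qed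

end

section \<open>Isotropic subgroups with semi-simple quotient\<close>

lemma (in comm_group) adjoin_subset:
  assumes S: "subgroup S G" and "N \<subseteq> S" "x \<in> S"
  shows "adjoin G N x \<subseteq> S"
  using assms subgroup_nat_pow_closed[OF S] subgroup.m_closed[OF S] by (auto simp: adjoin_def)

context split_form
begin

text \<open>Orthogonality gives \<open>upper \<subseteq> lower\<^sup>\<bottom>\<close>; equality follows from the orders, as
  \<open>|lower| |lower\<^sup>\<bottom>| = |M| \<le> |lower| |upper|\<close>.\<close>

lemma perp_lower:
  assumes nd: "nondegenerate M \<beta>"
  shows "perp M \<beta> lower = upper"
proof -
  have sub: "upper \<subseteq> perp M \<beta> lower"
  proof
    fix x assume x: "x \<in> upper"
    then have "\<beta> x l = \<one>\<^bsub>QZ\<^esub>" if "l \<in> lower" for l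
      using form_lower_upper[OF that x] form_sym level_in_M that by metis
    then show "x \<in> perp M \<beta> lower" using level_in_M[OF x] by (simp add: perp_def)
  qed
  have "i - (i + 1) div 2 = i div 2" for i :: nat by presburger
  then have "card (carrier M) \<le> card lower * card upper"
    using card_le_card_mult_level[OF fin, of "\<lambda>i. (i + 1) div 2"] by simp
  then have "card lower * card (perp M \<beta> lower) \<le> card lower * card upper"
    using card_mult_perp[OF nd subgroup_level] by simp
  moreover have "0 < card lower"
    using subgroup.one_closed[OF subgroup_level] finite_subset_carrier[OF subgroup.subset[OF subgroup_level]]
    by (auto simp: card_gt_0_iff)
  ultimately have "card (perp M \<beta> lower) \<le> card upper" by simp
  then show ?thesis
    using card_seteq[OF finite_subset_carrier[OF perp_subset] sub] by simp
qed

lemma perp_upper: "nondegenerate M \<beta> \<Longrightarrow> perp M \<beta> upper = lower"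
  using perp_lower perp_perp[OF _ subgroup_level] by metis

text \<open>A squarefree number that kills \<open>upper / lower\<close>.\<close>

definition prime_product :: nat
  where "prime_product = \<Prod>(fst ` T)"

lemma squarefree_prime_product: "squarefree prime_product"
  unfolding prime_product_def
proof (rule squarefree_prod_coprime)
  show "coprime p q" if "p \<in> fst ` T" "q \<in> fst ` T" "p \<noteq> q" for p q
    using that T_prime by (auto intro: primes_coprime)
  show "squarefree p" if "p \<in> fst ` T" for p
    using that T_prime by (auto intro: squarefree_prime)
qed

lemma dvd_prime_product: "(p, i) \<in> T \<Longrightarrow> p dvd prime_product"
  unfolding prime_product_def using finite_T by (intro dvd_prodI) force+

lemma pow_prime_product_mem_lower:
  assumes x: "x \<in> upper"
  shows "x [^] prime_product \<in> lower"
  unfolding level_def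
proof (intro CollectI conjI allI impI)
  have x_in: "x \<in> carrier M" using x level_in_M by blast
  then show "x [^] prime_product \<in> carrier M" by simp
  fix p i assume pi: "(p, i) \<in> T"
  obtain m where m: "prime_product = p * m" using dvd_prime_product[OF pi] by blast
  have "\<pi> p i x [^] (p ^ 1) \<in> pow_F p i (i div 2 + 1)"
    by (rule pow_mem_pow_F[OF levelD[OF x pi] pi])
  then have "\<pi> p i x [^] p \<in> pow_F p i ((i + 1) div 2)"
    using subsetD[OF pow_F_antimono[OF pi, of "(i + 1) div 2" "i div 2 + 1"]] by simp
  then have "(\<pi> p i x [^] p) [^] m \<in> pow_F p i ((i + 1) div 2)"
    by (rule subgroup_nat_pow_closed[OF subgroup_pow_F[OF pi]])
  then show "\<pi> p i (x [^] prime_product) \<in> pow_F p i ((i + 1) div 2)"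
    using x_in pi by (simp add: m proj_pow proj_in_M nat_pow_pow)
qed

definition semisimple_isotropic :: "'a set \<Rightarrow> bool"
  where "semisimple_isotropic L \<longleftrightarrow> subgroup L M \<and> L \<subseteq> perp M \<beta> L \<and>
    semisimple_group (M\<lparr>carrier := perp M \<beta> L\<rparr> Mod L)"

lemma semisimple_isotropic_iff:
  "semisimple_isotropic L \<longleftrightarrow> subgroup L M \<and> L \<subseteq> perp M \<beta> L \<and>
    (\<exists>d::nat. squarefree d \<and> (\<forall>x\<in>perp M \<beta> L. x [^] d \<in> L))"
  unfolding semisimple_isotropic_def
  using semisimple_quotient_iff[OF fin _ subgroup_perp] subgroup.subset by blast

lemma semisimple_isotropic_lower:
  assumes nd: "nondegenerate M \<beta>"
  shows "semisimple_isotropic lower"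
  unfolding semisimple_isotropic_iff perp_lower[OF nd]
  using subgroup_level lower_subset_upper squarefree_prime_product pow_prime_product_mem_lower by blast

text \<open>A non-trivial radical contains some \<open>y \<noteq> 0\<close> with \<open>p y = 0\<close>.  Its components are zero for the
  other primes and of the form \<open>p\<^sup>j\<^sup>-\<^sup>1 x\<^sub>j\<close> for \<open>p\<close>.  With \<open>i\<close> the least index of a non-zero component and
  \<open>x = x\<^sub>i\<close>, all \<open>p\<^sup>j\<^sup>-\<^sup>1\<close> with \<open>j > i\<close> kill \<open>x\<close>, so \<open>0 = \<beta> y x = p\<^sup>i\<^sup>-\<^sup>1 \<beta> x x\<close>; anisotropy puts \<open>x\<close>
  into \<open>p F p i\<close>, and the component \<open>p\<^sup>i\<^sup>-\<^sup>1 x\<close> is zero after all.\<close>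

lemma nondegenerate_if_anisotropic:
  assumes A: "\<And>p. Factorial_Ring.prime p \<Longrightarrow>
      anisotropic (V_space M F p odd_indices) (inv_multiples_mod_Z p) (V_form \<beta> p odd_indices) \<and>
      anisotropic (V_space M F p even_indices) (inv_multiples_mod_Z p) (V_form \<beta> p even_indices)"
  shows "nondegenerate M \<beta>"
  unfolding nondegenerate_iff_radical_trivial
proof (rule ccontr)
  let ?R = "perp M \<beta> (carrier M)"
  have R: "subgroup ?R M" by (rule subgroup_perp) simp
  assume "?R \<noteq> {\<one>}"
  then have "\<not> ?R \<subseteq> {\<one>}" using subgroup.one_closed[OF R] by blast
  then obtain y and p :: nat where y: "y \<in> ?R" "y \<notin> {\<one>}" and p: "Factorial_Ring.prime p" and yp: "y [^] p \<in> {\<one>}"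
    by (rule prime_pow_mem_if_not_subset[OF fin R triv_subgroup])
  have y_in: "y \<in> carrier M" using y(1) perp_subset by blast
  have proj_p: "\<pi> q i y [^] p = \<one>" if "(q, i) \<in> T" for q i
    using yp y_in that proj_one by (simp flip: proj_pow)
  have other: "\<pi> q i y = \<one>" if qi: "(q, i) \<in> T" "q \<noteq> p" for q i
  proof -
    have "\<pi> q i y \<in> pow_F q i i"
    proof (rule pow_F_coprime_pow[OF qi(1) proj_in[OF qi(1) y_in]])
      show "\<pi> q i y [^] p \<in> pow_F q i i"
        using proj_p[OF qi(1)] by (simp add: pow_F_top qi)
      show "coprime p q" using p T_prime[OF qi(1)] qi(2) by (simp add: primes_coprime)
    qed
    then show ?thesis by (simp add: pow_F_top qi)
  qed
  have bottom: "\<pi> p i y \<in> pow_F p i (i - 1)" if pi: "(p, i) \<in> T" for i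
  proof (rule pow_F_divide[OF pi proj_in[OF pi y_in]])
    show "\<pi> p i y [^] (p ^ 1) \<in> pow_F p i i"
      using proj_p[OF pi] by (simp add: pow_F_top pi)
  qed (use T_pos[OF pi] in auto)
  define i where "i = (LEAST i. (p, i) \<in> T \<and> \<pi> p i y \<noteq> \<one>)"
  have "\<exists>i. (p, i) \<in> T \<and> \<pi> p i y \<noteq> \<one>"
    using eq_one_if_proj[OF y_in] other y(2) by blast
  then have i: "(p, i) \<in> T" "\<pi> p i y \<noteq> \<one>"
    unfolding i_def by (metis (mono_tags, lifting) LeastI)+
  have below: "\<pi> p j y = \<one>" if "(p, j) \<in> T" "j < i" for j
    using that not_less_Least[of j "\<lambda>i. (p, i) \<in> T \<and> \<pi> p i y \<noteq> \<one>"] unfolding i_def by blast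
  obtain x where x: "x \<in> F p i" "\<pi> p i y = x [^] (p ^ (i - 1))"
    using bottom[OF i(1)] unfolding pow_F_def by blast
  have x_in: "x \<in> carrier M" by (rule F_in[OF i(1) x(1)])
  have "\<beta> y x = \<beta> (\<pi> p i y) x"
  proof (rule form_eq_single_proj[OF y_in x_in i(1)])
    fix q j assume qj: "(q, j) \<in> T" "(q, j) \<noteq> (p, i)"
    consider "q \<noteq> p" | "q = p" "j < i" | "q = p" "i < j" using qj by fastforce
    then show "\<beta> (\<pi> q j y) x = \<one>\<^bsub>QZ\<^esub>"
    proof cases
      case 3
      have "x \<in> pow_F p i 0" using x(1) i(1) by simp
      then show ?thesis
        using 3 bottom[of j] qj(1) by (intro form_pow_F_eq_one[OF qj(1) i(1)]) auto
    qed (use other below qj x_in in simp_all)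
  qed
  also have "\<dots> = \<beta> x x [^]\<^bsub>QZ\<^esub> (p ^ (i - 1))"
    using x_in by (simp add: x(2) form_pow_left)
  finally have xx: "\<beta> x x [^]\<^bsub>QZ\<^esub> (p ^ (i - 1)) = \<one>\<^bsub>QZ\<^esub>"
    using y(1) x_in by (simp add: perp_def)
  have key: "x \<in> pow_F p i 1" if J: "J \<subseteq> {0<..}" "i \<in> J"
    and A: "anisotropic (V_space M F p J) (inv_multiples_mod_Z p) (V_form \<beta> p J)" for J
  proof -
    let ?x = "\<lambda>j. if j = i then x else \<one>"
    have q: "finprod QZ (\<lambda>(q, j). if q = p \<and> j \<in> J then \<beta> (?x j) (?x j) [^]\<^bsub>QZ\<^esub> (p ^ (j - 1)) else \<one>\<^bsub>QZ\<^esub>) T = \<one>\<^bsub>QZ\<^esub>"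
      using xx by (intro QZ.finprod_one_eqI) (simp add: split_beta)
    have x_F: "\<forall>j\<in>J. (p, j) \<in> T \<longrightarrow> ?x j \<in> F p j"
      using x(1) subgroup.one_closed[OF subgroup_F] by simp
    have "\<forall>j\<in>J. (p, j) \<in> T \<longrightarrow> ?x j \<in> pow_F p j 1"
      by (rule A[unfolded V_anisotropic_iff[OF p J(1)], THEN spec, THEN mp, THEN mp, OF x_F q])
    then have "?x i \<in> pow_F p i 1" using i(1) J(2) by blast
    then show ?thesis by simp
  qed
  have "odd_indices \<subseteq> {0<..}" "even_indices \<subseteq> {0<..}" "i \<in> odd_indices \<or> i \<in> even_indices"
    using T_pos[OF i(1)] by (auto simp: odd_indices_def even_indices_def)
  then have "x \<in> pow_F p i 1"
    using key A[OF p] by blast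
  then have "x [^] (p ^ (i - 1)) \<in> pow_F p i (1 + (i - 1))"
    using pow_mem_pow_F i(1) by blast
  then show False
    using i x(2) T_pos[OF i(1)] by (simp add: pow_F_top)
qed

text \<open>The criteria bound both \<open>L\<close> and its orthogonal from above, \<open>L \<subseteq> lower\<close> and \<open>L\<^sup>\<bottom> \<subseteq> upper\<close>.  For
  a non-degenerate form the second inclusion turns into \<open>lower \<subseteq> L\<close>.\<close>

lemma semisimple_isotropic_unique:
  assumes nd: "nondegenerate M \<beta>"
    and odd: "\<And>(p::nat) y. Factorial_Ring.prime p \<Longrightarrow> y \<in> upper \<Longrightarrow> y [^] p \<in> lower \<Longrightarrow> \<beta> y y = \<one>\<^bsub>QZ\<^esub> \<Longrightarrow> y \<in> lower"
    and even: "\<And>(p::nat) y. Factorial_Ring.prime p \<Longrightarrow> y \<in> carrier M \<Longrightarrow> y [^] p \<in> lower \<Longrightarrow>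
      \<beta> y y [^]\<^bsub>QZ\<^esub> p = \<one>\<^bsub>QZ\<^esub> \<Longrightarrow> y \<in> upper"
    and L: "semisimple_isotropic L"
  shows "L = lower"
proof -
  let ?P = "perp M \<beta> L"
  obtain d :: nat where sub: "subgroup L M" and iso: "L \<subseteq> ?P" and d: "squarefree d" "\<And>x. x \<in> ?P \<Longrightarrow> x [^] d \<in> L"
    using L unfolding semisimple_isotropic_iff by blast
  have L_in: "L \<subseteq> carrier M" using subgroup.subset[OF sub] .
  have subP: "subgroup ?P M" by (rule subgroup_perp[OF L_in])
  have L_lower: "L \<subseteq> lower"
  proof (rule ccontr)
    assume "\<not> L \<subseteq> lower"
    then obtain x and p :: nat where x: "x \<in> L" "x \<notin> lower" and p: "Factorial_Ring.prime p" and xp: "x [^] p \<in> lower"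
      by (rule prime_pow_mem_if_not_subset[OF fin sub subgroup_level])
    have x_in: "x \<in> carrier M" using x(1) L_in by blast
    have xx: "\<beta> x x = \<one>\<^bsub>QZ\<^esub>" using x(1) iso unfolding perp_def by blast
    have "x \<in> upper" by (rule even[OF p x_in xp]) (simp add: xx)
    then show False using odd[OF p _ xp xx] x(2) by blast
  qed
  have P_upper: "?P \<subseteq> upper"
  proof (rule ccontr)
    assume "\<not> ?P \<subseteq> upper"
    then obtain y and p :: nat where y: "y \<in> ?P" "y \<notin> upper" and p: "Factorial_Ring.prime p" and yp: "y [^] p \<in> upper"
      by (rule prime_pow_mem_if_not_subset[OF fin subP subgroup_level])
    have y_in: "y \<in> carrier M" using y(1) perp_subset by blast
    have "y [^] d \<in> upper" using d(2)[OF y(1)] L_lower lower_subset_upper by blast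
    then have "\<not> coprime p d"
      using mem_subgroup_if_coprime_pows[OF subgroup_level y_in yp] y(2) by blast
    then have "p dvd d" using p prime_imp_coprime by blast
    then obtain m where m: "d = p * m" by blast
    \<comment> \<open>As \<open>d\<close> is squarefree, its cofactor \<open>m\<close> is prime to \<open>p\<close>, so \<open>m y\<close> stays outside \<open>upper\<close>.\<close>
    have "\<not> p dvd m"
    proof
      assume "p dvd m"
      then have "p ^ 2 dvd d" by (simp add: m power2_eq_square)
      then have "p dvd 1" by (rule squarefreeD[OF d(1)])
      then show False using p by simp
    qed
    then have "coprime p m" using p prime_imp_coprime by blast
    let ?z = "y [^] m"
    have z: "?z \<in> ?P" "?z \<in> carrier M" using subgroup_nat_pow_closed[OF subP y(1)] y_in by auto
    have zp: "?z [^] p \<in> L" using d(2)[OF y(1)] y_in by (simp add: m nat_pow_pow mult.commute)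
    have "\<beta> ?z ?z [^]\<^bsub>QZ\<^esub> p = \<beta> ?z (?z [^] p)" using z(2) by (simp only: form_pow_right)
    also have "\<dots> = \<one>\<^bsub>QZ\<^esub>" using z(1) zp unfolding perp_def by blast
    finally have "?z \<in> upper" using even[OF p z(2)] zp L_lower by blast
    then show False
      using mem_subgroup_if_coprime_pows[OF subgroup_level y_in yp _ \<open>coprime p m\<close>] y(2) by blast
  qed
  have "lower = perp M \<beta> upper" by (rule perp_upper[OF nd, symmetric])
  also have "\<dots> \<subseteq> perp M \<beta> ?P" by (rule perp_antimono[OF P_upper])
  also have "\<dots> = L" by (rule perp_perp[OF nd sub])
  finally show ?thesis using L_lower by blast
qed

text \<open>The subgroup \<open>lower + \<langle>y\<rangle>\<close> is isotropic because \<open>y\<close> is isotropic and orthogonal to \<open>lower\<close>, and its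
  quotient is a subquotient of the semi-simple group \<open>upper / lower\<close>.\<close>

lemma odd_criterion_if_unique:
  assumes nd: "nondegenerate M \<beta>" and unique: "\<And>L. semisimple_isotropic L \<Longrightarrow> L = lower"
    and y: "y \<in> upper" "\<beta> y y = \<one>\<^bsub>QZ\<^esub>"
  shows "y \<in> lower"
proof -
  let ?L = "adjoin M lower y"
  note sub = subgroup_level[of "\<lambda>i. (i + 1) div 2"]
  have y_in: "y \<in> carrier M" using y(1) level_in_M by blast
  have L: "lower \<subseteq> ?L" "y \<in> ?L" by (rule adjoin_supset[OF sub y_in])+
  have L_upper: "?L \<subseteq> upper"
    by (rule adjoin_subset[OF subgroup_level lower_subset_upper y(1)])
  have "lower \<subseteq> perp M \<beta> {y}" "y \<in> perp M \<beta> {y}"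
    using form_lower_upper[OF _ y(1)] level_in_M y y_in by (simp_all add: perp_def subset_iff)
  then have L_y: "?L \<subseteq> perp M \<beta> {y}"
    using y_in by (intro adjoin_subset subgroup_perp) auto
  have "?L \<subseteq> perp M \<beta> ?L"
  proof
    fix w assume w: "w \<in> ?L"
    show "w \<in> perp M \<beta> ?L"
    proof (rule perp_adjoin[OF subgroup.subset[OF sub] sub y_in])
      show "w \<in> perp M \<beta> lower" using w L_upper perp_lower[OF nd] by blast
      show "\<beta> w y = \<one>\<^bsub>QZ\<^esub>" using w L_y unfolding perp_def by blast
    qed
  qed
  moreover have "perp M \<beta> ?L \<subseteq> upper"
    using perp_antimono[OF L(1)] perp_lower[OF nd] by blast
  then have "\<forall>x\<in>perp M \<beta> ?L. x [^] prime_product \<in> ?L"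
    using pow_prime_product_mem_lower L(1) by blast
  ultimately have "semisimple_isotropic ?L"
    unfolding semisimple_isotropic_iff using adjoin_subgroup[OF sub y_in fin] squarefree_prime_product by blast
  then show ?thesis using unique L(2) by blast
qed

text \<open>If \<open>y\<close> is not in \<open>upper = lower\<^sup>\<bottom>\<close>, then \<open>lower \<inter> y\<^sup>\<bottom>\<close> is smaller than \<open>lower\<close>.  It is isotropic, and
  its orthogonal \<open>upper + \<langle>y\<rangle>\<close> is still mapped into it by \<open>prime_product\<close>: this sends \<open>upper\<close> and
  \<open>y\<close> to \<open>lower\<close>, the image of \<open>n \<in> upper\<close> pairs with \<open>y\<close> as \<open>n\<close> pairs with the image of \<open>y\<close>,
  which is zero, and the image of \<open>y\<close> pairs trivially with \<open>y\<close> since \<open>p \<beta> y y = 0\<close>.\<close>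

lemma even_criterion_if_unique:
  assumes nd: "nondegenerate M \<beta>" and unique: "\<And>L. semisimple_isotropic L \<Longrightarrow> L = lower"
    and p: "Factorial_Ring.prime (p::nat)" and y_in: "y \<in> carrier M"
    and y: "y [^] p \<in> lower" "\<beta> y y [^]\<^bsub>QZ\<^esub> p = \<one>\<^bsub>QZ\<^esub>"
  shows "y \<in> upper"
proof (rule ccontr)
  assume y_upper: "y \<notin> upper"
  let ?H = "adjoin M upper y" and ?L = "lower \<inter> perp M \<beta> {y}"
  note sub = subgroup_level[of "\<lambda>i. i div 2"]
  have up_in: "upper \<subseteq> carrier M" by (rule subgroup.subset[OF sub])
  have H: "upper \<subseteq> ?H" "y \<in> ?H" by (rule adjoin_supset[OF sub y_in])+
  have subH: "subgroup ?H M" by (rule adjoin_subgroup[OF sub y_in fin])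
  have "perp M \<beta> ?H = ?L"
  proof
    show "perp M \<beta> ?H \<subseteq> ?L"
      using perp_antimono[OF H(1)] perp_upper[OF nd] perp_antimono[of "{y}" ?H] H(2) by blast
    show "?L \<subseteq> perp M \<beta> ?H"
    proof
      fix w assume "w \<in> ?L"
      then show "w \<in> perp M \<beta> ?H"
        using perp_upper[OF nd] by (intro perp_adjoin[OF up_in sub y_in]) (auto simp: perp_def)
    qed
  qed
  then have perp_L: "perp M \<beta> ?L = ?H" using perp_perp[OF nd subH] by simp
  have subL: "subgroup ?L M"
    using y_in by (intro subgroups_Inter_pair subgroup_level subgroup_perp) auto
  \<comment> \<open>The prime \<open>p\<close> must be among the factors of \<open>prime_product\<close>: otherwise \<open>p\<close> would be invertible
    on \<open>M\<close> and \<open>y\<close> would lie in \<open>lower\<close>.\<close>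
  have "\<exists>i. (p, i) \<in> T"
  proof (rule ccontr)
    assume "\<not> (\<exists>i. (p, i) \<in> T)"
    then have "\<pi> q i y \<in> pow_F q i ((i + 1) div 2)" if "(q, i) \<in> T" for q i
      using level_if_pow_mem_level[OF p y_in y(1) that] that by blast
    then have "y \<in> lower" using y_in by (simp add: level_def)
    then show False using y_upper lower_subset_upper by blast
  qed
  then obtain m where m: "prime_product = p * m" using dvd_prime_product by blast
  have yr: "y [^] prime_product \<in> lower"
    using subgroup_nat_pow_closed[OF subgroup_level y(1), of m] y_in by (simp add: m nat_pow_pow)
  have yr_y: "\<beta> (y [^] prime_product) y = \<one>\<^bsub>QZ\<^esub>"
    using y(2) y_in by (simp add: m form_pow_left QZ.nat_pow_pow[symmetric])
  have yr_L: "y [^] prime_product \<in> ?L" using yr yr_y y_in by (simp add: perp_def)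
  have nr_L: "n [^] prime_product \<in> ?L" if n: "n \<in> upper" for n
  proof -
    have n_in: "n \<in> carrier M" using n up_in by blast
    have "\<beta> (n [^] prime_product) y = \<beta> (y [^] prime_product) n"
      using n_in y_in by (simp add: form_pow_left form_sym[of n y])
    also have "\<dots> = \<one>\<^bsub>QZ\<^esub>" by (rule form_lower_upper[OF yr n])
    finally show ?thesis using pow_prime_product_mem_lower[OF n] n_in by (simp add: perp_def)
  qed
  have "w [^] prime_product \<in> ?L" if "w \<in> ?H" for w
  proof -
    from that obtain n k where w: "n \<in> upper" "w = n \<otimes> y [^] (k::nat)"
      unfolding adjoin_def by blast
    have "w [^] prime_product = n [^] prime_product \<otimes> (y [^] prime_product) [^] k"
      using w up_in y_in by (simp add: nat_pow_distrib nat_pow_pow mult.commute subset_iff)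
    then show ?thesis
      using subgroup.m_closed[OF subL nr_L[OF w(1)] subgroup_nat_pow_closed[OF subL yr_L]] by simp
  qed
  moreover have "?L \<subseteq> ?H" using lower_subset_upper H(1) by blast
  ultimately have "semisimple_isotropic ?L"
    unfolding semisimple_isotropic_iff perp_L using subL squarefree_prime_product by blast
  then have "lower \<subseteq> perp M \<beta> {y}" using unique by blast
  then have "{y} \<subseteq> perp M \<beta> lower"
    using subset_perp_swap[of lower "{y}"] level_in_M y_in by blast
  then show False using y_upper perp_lower[OF nd] by blast
qed

end

theorem theorem2p1:
  fixes M :: "('a, 'b) monoid_scheme"
    and \<beta> :: "'a \<Rightarrow> 'a \<Rightarrow> rat set"
    and F :: "nat \<Rightarrow> nat \<Rightarrow> 'a set"
  assumes "comm_group M" and "finite (carrier M)"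
    and "symmetric_bilinear_form M QZ \<beta>"
    and "primary_decomposition M F"
  shows "(\<forall>p. Factorial_Ring.prime p \<longrightarrow>
            anisotropic (V_space M F p odd_indices) (inv_multiples_mod_Z p) (V_form \<beta> p odd_indices) \<and>
            anisotropic (V_space M F p even_indices) (inv_multiples_mod_Z p) (V_form \<beta> p even_indices))
     \<longleftrightarrow>
         nondegenerate M \<beta> \<and>
         (\<exists>!L. subgroup L M \<and> L \<subseteq> perp M \<beta> L \<and>
               semisimple_group (M\<lparr>carrier := perp M \<beta> L\<rparr> Mod L))"
proof -
  interpret comm_group M by fact
  obtain \<pi> where "primary_split M F \<pi> {(p, i). Factorial_Ring.prime p \<and> 0 < i \<and> F p i \<noteq> {\<one>\<^bsub>M\<^esub>}}"
    using primary_split_exists assms by blast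
  then interpret split_form M \<beta> F \<pi> "{(p, i). Factorial_Ring.prime p \<and> 0 < i \<and> F p i \<noteq> {\<one>\<^bsub>M\<^esub>}}"
    using assms by (intro split_form.intro finite_bilinear_group.intro finite_bilinear_group_axioms.intro
      split_form_axioms.intro)
  show ?thesis
    unfolding semisimple_isotropic_def[symmetric]
  proof
    assume A: "\<forall>p. Factorial_Ring.prime p \<longrightarrow>
        anisotropic (V_space M F p odd_indices) (inv_multiples_mod_Z p) (V_form \<beta> p odd_indices) \<and>
        anisotropic (V_space M F p even_indices) (inv_multiples_mod_Z p) (V_form \<beta> p even_indices)"
    then have nd: "nondegenerate M \<beta>" using nondegenerate_if_anisotropic by blast
    have "L = lower" if "semisimple_isotropic L" for L
      using that
    proof (rule semisimple_isotropic_unique[OF nd, rotated 2])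
      fix p :: nat and y assume "Factorial_Ring.prime p" "y \<in> upper" "y [^]\<^bsub>M\<^esub> p \<in> lower" "\<beta> y y = \<one>\<^bsub>QZ\<^esub>"
      then show "y \<in> lower" using A anisotropic_odd_iff[of p] by blast
    next
      fix p :: nat and y assume "Factorial_Ring.prime p" "y \<in> carrier M" "y [^]\<^bsub>M\<^esub> p \<in> lower"
        "\<beta> y y [^]\<^bsub>QZ\<^esub> p = \<one>\<^bsub>QZ\<^esub>"
      then show "y \<in> upper" using A anisotropic_even_iff[of p] by blast
    qed
    then show "nondegenerate M \<beta> \<and> (\<exists>!L. semisimple_isotropic L)"
      using nd semisimple_isotropic_lower[OF nd] by blast
  next
    assume B: "nondegenerate M \<beta> \<and> (\<exists>!L. semisimple_isotropic L)"
    then have nd: "nondegenerate M \<beta>" by (rule conjunct1)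
    have unique: "L = lower" if "semisimple_isotropic L" for L
      using B that semisimple_isotropic_lower[OF nd] by blast
    show "\<forall>p. Factorial_Ring.prime p \<longrightarrow>
        anisotropic (V_space M F p odd_indices) (inv_multiples_mod_Z p) (V_form \<beta> p odd_indices) \<and>
        anisotropic (V_space M F p even_indices) (inv_multiples_mod_Z p) (V_form \<beta> p even_indices)"
    proof (intro allI impI conjI)
      fix p assume p: "Factorial_Ring.prime (p::nat)"
      show "anisotropic (V_space M F p odd_indices) (inv_multiples_mod_Z p) (V_form \<beta> p odd_indices)"
        unfolding anisotropic_odd_iff[OF p] using odd_criterion_if_unique[OF nd unique] by blast
      show "anisotropic (V_space M F p even_indices) (inv_multiples_mod_Z p) (V_form \<beta> p even_indices)"
        unfolding anisotropic_even_iff[OF p] using even_criterion_if_unique[OF nd unique p] by blast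
    qed
  qed
qed

end
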